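(* Let $G$ be a connected graph on $n\geq 3$ vertices. Then $\lambda_1(G)+\lambda_2(G)\geq d_1(G)+d_2(G)+1$, with equality if and only if $G$ is the star $S_n$.
   Context: $L(G)=D-A$ is the Laplacian matrix of $G$ (degree diagonal matrix minus adjacency matrix), with eigenvalues $\lambda_1(G)\geq\lambda_2(G)\geq\cdots\geq\lambda_n(G)=0$; $d_1(G)\geq d_2(G)\geq\cdots\geq d_n(G)$ is the non-increasing degree sequence. $S_n$ is the star $K_{1,n-1}$. *)

theory Defs
  imports
    "Graph_Theory.Graph_Theory"
    "Jordan_Normal_Form.Char_Poly"
    "HOL-Library.Multiset"
begin

text \<open>
  Finite simple graphs are rendered by the locale \<^locale>\<open>graph\<close>, i.e. as loop-free symmetric
  digraphs without multiple arcs: every edge \<open>uv\<close> is a pair of opposite arcs, so the degree of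
  a vertex is its \<^const>\<open>out_degree\<close>. Matrices are indexed by natural numbers, so the matrices of
  a graph are taken relative to an enumeration \<open>vs\<close> of its vertices.
\<close>

definition adjacency_mat :: "('a, 'b) pre_digraph \<Rightarrow> 'a list \<Rightarrow> real mat" where
  "adjacency_mat G vs =
     mat (length vs) (length vs) (\<lambda>(i, j). if (vs ! i, vs ! j) \<in> arcs_ends G then 1 else 0)"

definition degree_mat :: "('a, 'b) pre_digraph \<Rightarrow> 'a list \<Rightarrow> real mat" where
  "degree_mat G vs = mat_diag (length vs) (\<lambda>i. real (out_degree G (vs ! i)))"

definition laplacian_mat :: "('a, 'b) pre_digraph \<Rightarrow> 'a list \<Rightarrow> real mat" where
  "laplacian_mat G vs = degree_mat G vs - adjacency_mat G vs"

text \<open>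
  The \<open>k\<close>-th largest eigenvalue and the \<open>k\<close>-th largest degree, counted from \<open>k = 1\<close> and with
  multiplicity. The Laplacian is symmetric, so its \<open>n\<close> eigenvalues are exactly the real roots of
  its characteristic polynomial.
\<close>

definition laplacian_eigenvalue :: "('a, 'b) pre_digraph \<Rightarrow> 'a list \<Rightarrow> nat \<Rightarrow> real" where
  "laplacian_eigenvalue G vs k =
     rev (sorted_list_of_multiset (proots (char_poly (laplacian_mat G vs)))) ! (k - 1)"

definition ordered_degree :: "('a, 'b) pre_digraph \<Rightarrow> nat \<Rightarrow> nat" where
  "ordered_degree G k =
     rev (sorted_list_of_multiset (image_mset (out_degree G) (mset_set (verts G)))) ! (k - 1)"

text \<open>The star on \<open>n\<close> vertices, as a property that is invariant under isomorphism.\<close>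

definition is_star :: "nat \<Rightarrow> ('a, 'b) pre_digraph \<Rightarrow> bool" where
  "is_star n G \<longleftrightarrow> complete_bipartite_digraph 1 (n - 1) G"

end

theory Submission
  imports Defs "HOL-Analysis.Function_Topology" "HOL-Analysis.Convex"
begin

text \<open>
  By Ky Fan's principle, \<open>\<lambda>\<^sub>1 + \<lambda>\<^sub>2\<close> is the maximum of \<open>tr (L M)\<close> over symmetric \<open>M\<close> with
  \<open>0 \<le> M \<le> I\<close> and \<open>tr M = 2\<close>. Let \<open>u\<close>, \<open>v\<close> be vertices of largest degrees and \<open>A\<close> the set of
  their neighbours other than \<open>u\<close>, \<open>v\<close>. Take for \<open>M\<close> the projection onto the span of \<open>1\<^sub>u\<close>, \<open>1\<^sub>v\<close>,
  \<open>1\<^sub>A\<close> minus the projection onto the vector \<open>1\<^sub>u + 1\<^sub>v + 1\<^sub>A\<close>. This gives at least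
  \<open>d\<^sub>1 + d\<^sub>2 + 1\<close>, with a strict inequality if \<open>u\<close>, \<open>v\<close> have a common neighbour or if \<open>A\<close> has an
  edge to a vertex outside \<open>{u, v} \<union> A\<close>.

  In the remaining case the other vertices split into the private neighbours \<open>A\<close> of \<open>u\<close> and \<open>B\<close> of
  \<open>v\<close>. If \<open>A\<close> or \<open>B\<close> is empty, the graph is a star. Otherwise project onto the span of \<open>1\<^sub>u\<close>,
  \<open>1\<^sub>v\<close>, \<open>1\<^sub>A\<close>, \<open>1\<^sub>B\<close> and remove the constants and the vector
  \<open>y = \<delta> (1\<^sub>u - 1\<^sub>v) + 1\<^sub>A / |A| - 1\<^sub>B / |B|\<close>. For \<open>\<delta> = 0\<close> this gives \<open>d\<^sub>1 + d\<^sub>2 + 1\<close> again, but \<open>y\<close> is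
  then not an eigenvector of the compression, so that a small \<open>\<delta> > 0\<close> gives more.

  For the star with centre \<open>c\<close> and \<open>h = 1\<^sub>c - 1/n\<close>, the form of \<open>L\<close> is at most \<open>|x|\<^sup>2 + n (x \<bullet> h)\<^sup>2\<close>.
  Since \<open>n |h|\<^sup>2 = n - 1\<close>, two orthonormal vectors contribute at most \<open>n + 1 = d\<^sub>1 + d\<^sub>2 + 1\<close>.
\<close>

section \<open>Spectral theorem for symmetric kernels\<close>

text \<open>Vectors are functions on the whole type of which only the values on \<open>V\<close>
  count. This keeps the spectral argument independent of any enumeration of the vertices.\<close>

definition ip :: "'a set \<Rightarrow> ('a \<Rightarrow> real) \<Rightarrow> ('a \<Rightarrow> real) \<Rightarrow> real" where
  "ip V x y = (\<Sum>v\<in>V. x v * y v)"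

definition kernel_app :: "'a set \<Rightarrow> ('a \<Rightarrow> 'a \<Rightarrow> real) \<Rightarrow> ('a \<Rightarrow> real) \<Rightarrow> 'a \<Rightarrow> real" where
  "kernel_app V K x v = (\<Sum>w\<in>V. K v w * x w)"

lemma ip_commute: "ip V x y = ip V y x"
  by (simp add: ip_def mult.commute)

lemma ip_add_left: "ip V (\<lambda>v. x v + y v) z = ip V x z + ip V y z"
  and ip_diff_left: "ip V (\<lambda>v. x v - y v) z = ip V x z - ip V y z"
  and ip_scale_left: "ip V (\<lambda>v. c * x v) z = c * ip V x z"
  and ip_add_right: "ip V z (\<lambda>v. x v + y v) = ip V z x + ip V z y"
  and ip_diff_right: "ip V z (\<lambda>v. x v - y v) = ip V z x - ip V z y"
  and ip_scale_right: "ip V z (\<lambda>v. c * x v) = c * ip V z x"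
  by (simp_all add: ip_def algebra_simps sum.distrib sum_subtractf sum_distrib_left)

lemmas ip_linear = ip_add_left ip_diff_left ip_scale_left ip_add_right ip_diff_right ip_scale_right

lemma ip_sum_left: "ip V (\<lambda>v. \<Sum>i\<in>I. x i v) z = (\<Sum>i\<in>I. ip V (x i) z)"
  unfolding ip_def sum_distrib_right by (rule sum.swap)

lemma ip_nonneg: "0 \<le> ip V x x"
  by (simp add: ip_def sum_nonneg)

lemma ip_eq_0D: "finite V \<Longrightarrow> ip V x x = 0 \<Longrightarrow> v \<in> V \<Longrightarrow> x v = 0"
  unfolding ip_def by (subst (asm) sum_nonneg_eq_0_iff) auto

lemma ip_cong: "(\<And>v. v \<in> V \<Longrightarrow> x v = x' v) \<Longrightarrow> (\<And>v. v \<in> V \<Longrightarrow> y v = y' v) \<Longrightarrow> ip V x y = ip V x' y'"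
  unfolding ip_def by (intro sum.cong) auto

lemma kernel_app_linear:
  "kernel_app V K (\<lambda>v. x v + y v) = (\<lambda>v. kernel_app V K x v + kernel_app V K y v)"
  "kernel_app V K (\<lambda>v. c * x v) = (\<lambda>v. c * kernel_app V K x v)"
  by (simp_all add: kernel_app_def fun_eq_iff algebra_simps sum.distrib sum_distrib_left)

lemma kernel_app_cong: "(\<And>v. v \<in> V \<Longrightarrow> x v = y v) \<Longrightarrow> kernel_app V K x = kernel_app V K y"
  by (simp add: kernel_app_def fun_eq_iff)

lemma ip_kernel_app_commute:
  assumes "\<And>v w. v \<in> V \<Longrightarrow> w \<in> V \<Longrightarrow> K v w = K w v"
  shows "ip V x (kernel_app V K y) = ip V y (kernel_app V K x)"
proof -
  have "ip V x (kernel_app V K y) = (\<Sum>v\<in>V. \<Sum>w\<in>V. x v * K v w * y w)"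
    by (simp add: ip_def kernel_app_def sum_distrib_left mult.assoc)
  also have "\<dots> = (\<Sum>w\<in>V. \<Sum>v\<in>V. x v * K v w * y w)"
    by (rule sum.swap)
  also have "\<dots> = ip V y (kernel_app V K x)"
    by (auto simp: ip_def kernel_app_def sum_distrib_left assms mult_ac intro!: sum.cong)
  finally show ?thesis .
qed

text \<open>The residuals of the standard basis serve twice: for \<open>k < card V\<close> one of them is nonzero, for
  \<open>k = card V\<close> all of them vanish, which is completeness.\<close>

lemma projection_residual:
  fixes e :: "nat \<Rightarrow> 'a \<Rightarrow> real"
  assumes fin: "finite V"
    and orth: "\<And>i j. i < k \<Longrightarrow> j < k \<Longrightarrow> ip V (e i) (e j) = (if i = j then 1 else 0)"
  defines "r \<equiv> \<lambda>v w. (if w = v then 1 else 0) - (\<Sum>i<k. e i v * e i w)"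
  shows "v \<in> V \<Longrightarrow> j < k \<Longrightarrow> ip V (r v) (e j) = 0"
    and "(\<Sum>v\<in>V. ip V (r v) (r v)) = real (card V) - real k"
proof -
  have *: "ip V (r v) (e j) = 0" if "v \<in> V" "j < k" for v j
  proof -
    have "ip V (r v) (e j) = ip V (\<lambda>w. if w = v then 1 else 0) (e j) - (\<Sum>i<k. ip V (\<lambda>w. e i v * e i w) (e j))"
      unfolding r_def by (simp add: ip_linear ip_sum_left)
    also have "ip V (\<lambda>w. if w = v then 1 else 0) (e j) = (\<Sum>w\<in>V. if w = v then e j w else 0)"
      unfolding ip_def by (intro sum.cong) auto
    also have "\<dots> = e j v"
      using that fin by simp
    also have "(\<Sum>i<k. ip V (\<lambda>w. e i v * e i w) (e j)) = (\<Sum>i<k. if i = j then e j v else 0)"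
      using that by (intro sum.cong) (auto simp: ip_linear orth)
    also have "\<dots> = e j v"
      using that by simp
    finally show ?thesis by simp
  qed
  have "ip V (r v) (r v) = 1 - (\<Sum>i<k. (e i v)\<^sup>2)" if "v \<in> V" for v
  proof -
    have "ip V (r v) (r v) = ip V (\<lambda>w. if w = v then 1 else 0) (r v) - (\<Sum>i<k. e i v * ip V (e i) (r v))"
      by (subst (1) r_def) (simp add: ip_linear ip_sum_left)
    also have "(\<Sum>i<k. e i v * ip V (e i) (r v)) = 0"
      by (rule sum.neutral) (use * that in \<open>auto simp: ip_commute[of V "e _"]\<close>)
    also have "ip V (\<lambda>w. if w = v then 1 else 0) (r v) = (\<Sum>w\<in>V. if w = v then r v w else 0)"
      unfolding ip_def by (intro sum.cong) auto
    also have "\<dots> = 1 - (\<Sum>i<k. (e i v)\<^sup>2)"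
      using that fin by (simp add: r_def power2_eq_square)
    finally show ?thesis by simp
  qed
  then have "(\<Sum>v\<in>V. ip V (r v) (r v)) = real (card V) - (\<Sum>v\<in>V. \<Sum>i<k. (e i v)\<^sup>2)"
    by (simp add: sum_subtractf)
  also have "(\<Sum>v\<in>V. \<Sum>i<k. (e i v)\<^sup>2) = (\<Sum>i<k. ip V (e i) (e i))"
    unfolding ip_def power2_eq_square by (rule sum.swap)
  also have "\<dots> = k"
    using orth by simp
  finally show "(\<Sum>v\<in>V. ip V (r v) (r v)) = real (card V) - real k" .
  show "v \<in> V \<Longrightarrow> j < k \<Longrightarrow> ip V (r v) (e j) = 0"
    by (rule *)
qed

text \<open>Requiring \<open>x\<close> to vanish off \<open>V\<close> places the set inside a
  product of intervals \<open>{-1..1}\<close> and points \<open>{0}\<close>, which is compact by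
  Tychonoff. The remaining conditions are closed because \<open>ip\<close> depends continuously on
  finitely many coordinates.\<close>

lemma compact_unit_vectors:
  fixes e :: "nat \<Rightarrow> 'a \<Rightarrow> real"
  assumes fin: "finite V"
  shows "compact {x. (\<forall>v. v \<notin> V \<longrightarrow> x v = 0) \<and> ip V x x = 1 \<and> (\<forall>i<k. ip V x (e i) = 0)}" (is "compact ?S")
proof -
  define C where "C = (\<lambda>v. if v \<in> V then {-1..1::real} else {0})"
  have "compactin (product_topology (\<lambda>_. euclidean) UNIV) (PiE UNIV C)"
    unfolding compactin_PiE by (auto simp: C_def)
  then have "compact (PiE UNIV C)"
    by (simp add: euclidean_product_topology)
  moreover have "closed {x. ip V x x = 1 \<and> (\<forall>i<k. ip V x (e i) = 0)}"
  proof -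
    have "continuous_on UNIV (\<lambda>x. ip V x x)" "continuous_on UNIV (\<lambda>x. ip V x (e i))" for i
      unfolding ip_def by (intro continuous_intros continuous_on_product_coordinates)+
    then show ?thesis
      by (auto intro!: closed_Collect_conj closed_Collect_eq closed_Collect_all closed_Collect_imp)
  qed
  ultimately have "compact (PiE UNIV C \<inter> {x. ip V x x = 1 \<and> (\<forall>i<k. ip V x (e i) = 0)})"
    by (rule compact_Int_closed)
  also have "PiE UNIV C \<inter> {x. ip V x x = 1 \<and> (\<forall>i<k. ip V x (e i) = 0)} = ?S"
  proof -
    have "\<bar>x v\<bar> \<le> 1" if "ip V x x = 1" "v \<in> V" for x v
    proof -
      have "(x v)\<^sup>2 \<le> ip V x x"
        unfolding ip_def power2_eq_square using fin that by (intro member_le_sum) auto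
      then show ?thesis
        using that by (simp add: abs_square_le_1)
    qed
    then show ?thesis
      by (auto simp: C_def PiE_iff abs_le_iff split: if_splits)
  qed
  finally show ?thesis .
qed

text \<open>First-order condition at a minimum: for small \<open>t\<close> the linear term
  dominates. With \<open>a\<close> above \<open>c / 2\<close>, the choice \<open>t = - d / a\<close>
  makes the expression negative unless \<open>d = 0\<close>.\<close>

lemma linear_term_zero:
  fixes c d :: real
  assumes "\<And>t. 0 \<le> t\<^sup>2 * c + 2 * t * d"
  shows "d = 0"
proof (rule ccontr)
  assume "d \<noteq> 0"
  define a where "a = \<bar>c\<bar> + 1"
  have a: "a > 0" "c < 2 * a"
    by (auto simp: a_def)
  have "(- d / a)\<^sup>2 * c + 2 * (- d / a) * d = d\<^sup>2 / a * (c / a - 2)"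
    using a by (simp add: power2_eq_square field_simps)
  also have "\<dots> < 0"
    using \<open>d \<noteq> 0\<close> a by (intro mult_pos_neg divide_pos_pos) (auto simp: field_simps)
  finally show False
    using assms[of "- d / a"] by simp
qed

text \<open>One step of the greedy diagonalisation: \<open>x\<close> maximises the quadratic form of
  \<open>K\<close> over the compact unit sphere orthogonal to the eigenvectors found so far. The
  last conclusion records the maximality, from which the order of the eigenvalues follows.\<close>

lemma next_eigenvector:
  fixes K :: "'a \<Rightarrow> 'a \<Rightarrow> real" and e :: "nat \<Rightarrow> 'a \<Rightarrow> real"
  assumes fin: "finite V" and k: "k < card V"
    and sym: "\<And>v w. v \<in> V \<Longrightarrow> w \<in> V \<Longrightarrow> K v w = K w v"
    and orth: "\<And>i j. i < k \<Longrightarrow> j < k \<Longrightarrow> ip V (e i) (e j) = (if i = j then 1 else 0)"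
    and eig: "\<And>i v. i < k \<Longrightarrow> v \<in> V \<Longrightarrow> kernel_app V K (e i) v = l i * e i v"
  obtains x m where "ip V x x = 1" "\<And>i. i < k \<Longrightarrow> ip V x (e i) = 0"
    "\<And>v. v \<in> V \<Longrightarrow> kernel_app V K x v = m * x v"
    "\<And>y. \<forall>i<k. ip V y (e i) = 0 \<Longrightarrow> ip V y (kernel_app V K y) \<le> m * ip V y y"
proof -
  define q where "q = (\<lambda>x. ip V x (kernel_app V K x))"
  have comm: "ip V x (kernel_app V K y) = ip V y (kernel_app V K x)" for x y
    by (rule ip_kernel_app_commute) (rule sym)
  define S where "S = {x. (\<forall>v. v \<notin> V \<longrightarrow> x v = 0) \<and> ip V x x = 1 \<and> (\<forall>i<k. ip V x (e i) = 0)}"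
  have normalised: "(\<lambda>v. if v \<in> V then y v / sqrt (ip V y y) else 0) \<in> S"
    if "ip V y y \<noteq> 0" "\<And>i. i < k \<Longrightarrow> ip V y (e i) = 0" for y
  proof -
    let ?z = "\<lambda>v. if v \<in> V then y v / sqrt (ip V y y) else 0"
    have "ip V ?z z = ip V (\<lambda>v. 1 / sqrt (ip V y y) * y v) z" for z
      by (intro ip_cong) auto
    then have z: "ip V ?z z = ip V y z / sqrt (ip V y y)" for z
      by (simp only: ip_linear) simp
    have "ip V ?z ?z = ip V y y / (sqrt (ip V y y) * sqrt (ip V y y))"
      unfolding z by (subst ip_commute) (simp add: z)
    then show ?thesis
      using that z by (auto simp: S_def ip_nonneg)
  qed
  define r where "r v w = (if w = v then 1 else 0) - (\<Sum>i<k. e i v * e i w)" for v w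
  note res = projection_residual[where k = k and V = V and e = e, OF fin orth, folded r_def]
  have "(\<Sum>v\<in>V. ip V (r v) (r v)) \<noteq> 0"
    using res(2) k by simp
  then obtain v where "v \<in> V" "ip V (r v) (r v) \<noteq> 0"
    by (meson sum.neutral)
  then have "S \<noteq> {}"
    using normalised[of "r v"] res(1) by auto
  moreover have "continuous_on S q"
    unfolding q_def ip_def kernel_app_def
    by (intro continuous_intros continuous_on_subset[OF continuous_on_product_coordinates]) auto
  moreover have "compact S"
    unfolding S_def by (rule compact_unit_vectors[OF fin])
  ultimately obtain x where x: "x \<in> S" and max: "\<And>y. y \<in> S \<Longrightarrow> q y \<le> q x"
    using continuous_attains_sup by metis
  have le: "q y \<le> q x * ip V y y" if y: "\<And>i. i < k \<Longrightarrow> ip V y (e i) = 0" for y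
  proof (cases "ip V y y = 0")
    case True
    then have "y v = 0" if "v \<in> V" for v
      using ip_eq_0D[OF fin, of y v] that by blast
    then have "q y = 0"
      unfolding q_def ip_def by (intro sum.neutral) auto
    then show ?thesis using True by simp
  next
    case False
    let ?z = "\<lambda>v. if v \<in> V then y v / sqrt (ip V y y) else 0"
    let ?z' = "\<lambda>v. 1 / sqrt (ip V y y) * y v"
    have "kernel_app V K ?z = kernel_app V K ?z'"
      by (intro kernel_app_cong) auto
    then have "q ?z = q ?z'"
      unfolding q_def by (intro ip_cong) auto
    also have "\<dots> = 1 / sqrt (ip V y y) * (1 / sqrt (ip V y y)) * q y"
      unfolding q_def kernel_app_linear ip_linear by simp
    also have "1 / sqrt (ip V y y) * (1 / sqrt (ip V y y)) = 1 / ip V y y"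
      by (simp add: ip_nonneg flip: real_sqrt_mult)
    finally have "q y / ip V y y \<le> q x"
      using max[OF normalised[OF False y]] by simp
    then show ?thesis
      using False ip_nonneg[of V y] by (simp add: field_simps)
  qed
  have xx: "ip V x x = 1" and xe: "\<And>i. i < k \<Longrightarrow> ip V x (e i) = 0"
    using x by (auto simp: S_def)
  \<comment> \<open>The gradient of the Rayleigh quotient at the maximiser \<open>x\<close> lies in the orthogonal complement
      of the \<open>e i\<close> and therefore vanishes.\<close>
  define y where "y = (\<lambda>v. q x * x v - kernel_app V K x v)"
  have ye: "ip V y (e i) = 0" if "i < k" for i
  proof -
    have "ip V (kernel_app V K x) (e i) = ip V x (kernel_app V K (e i))"
      using comm[of x "e i"] ip_commute[of V _ "e i"] by simp
    also have "\<dots> = ip V x (\<lambda>v. l i * e i v)"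
      using eig that by (intro ip_cong) auto
    finally show ?thesis
      using that by (simp add: y_def ip_linear xe)
  qed
  have "q x * ip V x y - ip V y (kernel_app V K x) = 0"
  proof (rule linear_term_zero)
    fix t :: real
    have "q (\<lambda>v. x v + t * y v) \<le> q x * ip V (\<lambda>v. x v + t * y v) (\<lambda>v. x v + t * y v)"
      by (rule le) (simp add: ip_linear xe ye)
    moreover have "q (\<lambda>v. x v + t * y v) = q x + 2 * t * ip V y (kernel_app V K x) + t\<^sup>2 * q y"
      unfolding q_def kernel_app_linear ip_linear
      using comm[of x y] by (simp add: algebra_simps power2_eq_square)
    moreover have "ip V (\<lambda>v. x v + t * y v) (\<lambda>v. x v + t * y v) = 1 + 2 * t * ip V x y + t\<^sup>2 * ip V y y"
      using ip_commute[of V x y] by (simp add: ip_linear xx algebra_simps power2_eq_square)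
    ultimately show "0 \<le> t\<^sup>2 * (q x * ip V y y - q y) + 2 * t * (q x * ip V x y - ip V y (kernel_app V K x))"
      by (simp add: algebra_simps)
  qed
  moreover have "ip V y y = q x * ip V x y - ip V y (kernel_app V K x)"
    by (subst (2) y_def) (simp add: ip_linear ip_commute)
  ultimately have "ip V y y = 0"
    by simp
  then have "kernel_app V K x v = q x * x v" if "v \<in> V" for v
    using ip_eq_0D[OF fin, of y v] that by (simp add: y_def)
  then show thesis
    using xx xe le[unfolded q_def] by (intro that[of x "q x"]) (simp_all only: q_def)
qed

text \<open>The last conjunct makes the greedily chosen eigenvalues decreasing.\<close>

lemma orthonormal_eigenvectors:
  fixes K :: "'a \<Rightarrow> 'a \<Rightarrow> real"
  assumes fin: "finite V" and sym: "\<forall>v\<in>V. \<forall>w\<in>V. K v w = K w v"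
    and "k \<le> card V"
  shows "\<exists>e l. (\<forall>i<k. \<forall>j<k. ip V (e i) (e j) = (if i = j then 1 else 0)) \<and>
    (\<forall>i<k. \<forall>v\<in>V. kernel_app V K (e i) v = l i * e i v) \<and>
    (\<forall>j<k. \<forall>i\<le>j. l j \<le> l i) \<and>
    (\<forall>j<k. \<forall>y. (\<forall>i<j. ip V y (e i) = 0) \<longrightarrow> ip V y (kernel_app V K y) \<le> l j * ip V y y)"
  using \<open>k \<le> card V\<close>
proof (induction k)
  case 0
  then show ?case by simp
next
  case (Suc k)
  from Suc.IH[OF Suc_leD[OF Suc.prems]] obtain e l where
    IH: "\<forall>i<k. \<forall>j<k. ip V (e i) (e j) = (if i = j then 1 else 0)"
      "\<forall>i<k. \<forall>v\<in>V. kernel_app V K (e i) v = l i * e i v"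
      "\<forall>j<k. \<forall>i\<le>j. l j \<le> l i"
      "\<forall>j<k. \<forall>y. (\<forall>i<j. ip V y (e i) = 0) \<longrightarrow> ip V y (kernel_app V K y) \<le> l j * ip V y y"
    by (elim exE conjE)
  note e = IH[rule_format]
  obtain x m where x: "ip V x x = 1" "\<And>i. i < k \<Longrightarrow> ip V x (e i) = 0"
    "\<And>v. v \<in> V \<Longrightarrow> kernel_app V K x v = m * x v"
    "\<And>y. \<forall>i<k. ip V y (e i) = 0 \<Longrightarrow> ip V y (kernel_app V K y) \<le> m * ip V y y"
    by (rule next_eigenvector[where k = k and K = K and V = V and e = e and l = l,
          OF fin Suc_le_lessD[OF Suc.prems] sym[rule_format] e(1,2)]; (assumption | rule that; assumption))
  \<comment> \<open>The new \<open>x\<close> is a competitor in every earlier maximisation, so its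
    Rayleigh quotient \<open>m\<close> is at most each \<open>l i\<close>.\<close>
  have "ip V x (kernel_app V K x) = ip V x (\<lambda>v. m * x v)"
    using x(3) by (intro ip_cong) auto
  then have m: "m \<le> l i" if "i < k" for i
    using e(4)[of i x] that x by (simp add: ip_linear)
  let ?e = "e(k := x)" and ?l = "l(k := m)"
  have "ip V (?e i) (?e j) = (if i = j then 1 else 0)" if "i < Suc k" "j < Suc k" for i j
    using that x(1) x(2)[of i] x(2)[of j] e(1)[of i j] ip_commute[of V "e i" x]
    by (cases "i = k"; cases "j = k") auto
  moreover have "kernel_app V K (?e i) v = ?l i * ?e i v" if "i < Suc k" "v \<in> V" for i v
    using that x(3)[of v] e(2)[of i v] by (cases "i = k") auto
  moreover have "?l j \<le> ?l i" if "j < Suc k" "i \<le> j" for i j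
    using that m[of i] e(3)[of j i] by (cases "j = k"; cases "i = k") auto
  moreover have "ip V y (kernel_app V K y) \<le> ?l j * ip V y y"
    if "j < Suc k" "\<forall>i<j. ip V y (?e i) = 0" for j y
    using that x(4)[of y] e(4)[of j y] by (cases "j = k") auto
  ultimately show ?case by blast
qed

lemma spectral_theorem:
  fixes K :: "'a \<Rightarrow> 'a \<Rightarrow> real"
  assumes fin: "finite V" and sym: "\<And>v w. v \<in> V \<Longrightarrow> w \<in> V \<Longrightarrow> K v w = K w v"
  obtains e l where
    "\<And>i j. i < card V \<Longrightarrow> j < card V \<Longrightarrow> ip V (e i) (e j) = (if i = j then 1 else 0)"
    "\<And>i v. i < card V \<Longrightarrow> v \<in> V \<Longrightarrow> kernel_app V K (e i) v = l i * e i v"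
    "\<And>i j. j < card V \<Longrightarrow> i \<le> j \<Longrightarrow> l j \<le> l i"
proof -
  have "\<forall>v\<in>V. \<forall>w\<in>V. K v w = K w v"
    using sym by blast
  from orthonormal_eigenvectors[OF fin this order_refl] obtain e l where
    *: "\<forall>i<card V. \<forall>j<card V. ip V (e i) (e j) = (if i = j then 1 else 0)"
      "\<forall>i<card V. \<forall>v\<in>V. kernel_app V K (e i) v = l i * e i v"
      "\<forall>j<card V. \<forall>i\<le>j. l j \<le> l i"
    by (elim exE conjE)
  show thesis
    by (rule that[of e l]) (use * in blast)+
qed

lemma orthonormal_complete:
  assumes fin: "finite V"
    and orth: "\<And>i j. i < card V \<Longrightarrow> j < card V \<Longrightarrow> ip V (e i) (e j) = (if i = j then 1 else 0)"
    and v: "v \<in> V" and w: "w \<in> V"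
  shows "(\<Sum>i<card V. e i v * e i w) = (if v = w then 1 else 0)"
proof -
  define r where "r v w = (if w = v then 1 else 0) - (\<Sum>i<card V. e i v * e i w)" for v w
  have "(\<Sum>v\<in>V. ip V (r v) (r v)) = 0"
    using projection_residual(2)[where k = "card V" and V = V and e = e, OF fin orth, folded r_def] by simp
  then have "ip V (r v) (r v) = 0"
    using fin v by (simp add: sum_nonneg_eq_0_iff ip_nonneg)
  then show ?thesis
    using ip_eq_0D[OF fin _ w, of "r v"] unfolding r_def[of v w] by (auto split: if_splits)
qed

lemma parseval:
  assumes fin: "finite V"
    and orth: "\<And>i j. i < card V \<Longrightarrow> j < card V \<Longrightarrow> ip V (e i) (e j) = (if i = j then 1 else 0)"
  shows "ip V x y = (\<Sum>i<card V. ip V x (e i) * ip V y (e i))"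
proof -
  have "(\<Sum>i<card V. ip V x (e i) * ip V y (e i))
      = (\<Sum>i<card V. \<Sum>v\<in>V. \<Sum>w\<in>V. x v * y w * (e i v * e i w))"
    by (simp add: ip_def sum_product mult_ac)
  also have "\<dots> = (\<Sum>v\<in>V. \<Sum>i<card V. \<Sum>w\<in>V. x v * y w * (e i v * e i w))"
    by (rule sum.swap)
  also have "\<dots> = (\<Sum>v\<in>V. \<Sum>w\<in>V. \<Sum>i<card V. x v * y w * (e i v * e i w))"
    by (intro sum.cong refl sum.swap)
  also have "\<dots> = (\<Sum>v\<in>V. \<Sum>w\<in>V. if v = w then x v * y w else 0)"
    by (intro sum.cong refl) (simp add: orthonormal_complete[OF fin orth] flip: sum_distrib_left)
  also have "\<dots> = ip V x y"
    using fin by (simp add: ip_def)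
  finally show ?thesis by simp
qed

section \<open>Eigenbases and characteristic polynomials\<close>

lemma proots_prod_linear_factors: "proots (\<Prod>a\<leftarrow>xs. [:- a, 1:]) = mset (xs :: real list)"
proof (induction xs)
  case (Cons a xs)
  have "(\<Prod>a\<leftarrow>xs. [:- a, 1:]) \<noteq> 0"
    by (auto simp: prod_list_zero_iff)
  then have "proots ([:- a, 1:] * (\<Prod>a\<leftarrow>xs. [:- a, 1:])) = proots [:- a, 1:] + proots (\<Prod>a\<leftarrow>xs. [:- a, 1:])"
    by (intro proots_mult) auto
  then show ?case
    unfolding list.map prod_list.Cons Cons.IH proots_linear_factor by simp
qed simp

lemma sum_nth_distinct:
  assumes "distinct vs"
  shows "(\<Sum>i\<in>{0..<length vs}. f (vs ! i)) = (\<Sum>v\<in>set vs. f v)"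
  by (rule sum.reindex_bij_betw) (use assms in \<open>simp add: bij_betw_nth atLeast0LessThan\<close>)

text \<open>The eigenvectors are the columns of \<open>P\<close>, and by orthonormality its
  transpose \<open>Q\<close> is its inverse. Thus \<open>A = P * D * Q\<close> is similar to the
  diagonal matrix of the \<open>l i\<close>.\<close>

lemma char_poly_orthonormal_eigenvectors:
  fixes K :: "'a \<Rightarrow> 'a \<Rightarrow> real"
  assumes vs: "distinct vs" "set vs = V" and n: "n = length vs"
    and orth: "\<And>i j. i < n \<Longrightarrow> j < n \<Longrightarrow> ip V (e i) (e j) = (if i = j then 1 else 0)"
    and eig: "\<And>i v. i < n \<Longrightarrow> v \<in> V \<Longrightarrow> kernel_app V K (e i) v = l i * e i v"
  shows "char_poly (mat n n (\<lambda>(i, j). K (vs ! i) (vs ! j))) = (\<Prod>a\<leftarrow>map l [0..<n]. [:- a, 1:])"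
proof -
  define A where "A = mat n n (\<lambda>(i, j). K (vs ! i) (vs ! j))"
  define P where "P = mat n n (\<lambda>(i, j). e j (vs ! i))"
  define Q where "Q = mat n n (\<lambda>(i, j). e i (vs ! j))"
  define D where "D = mat_diag n l"
  have carrier: "A \<in> carrier_mat n n" "P \<in> carrier_mat n n" "Q \<in> carrier_mat n n" "D \<in> carrier_mat n n"
    by (auto simp: A_def P_def Q_def D_def mat_diag_def)
  have sum_vs: "(\<Sum>k\<in>{0..<n}. f (vs ! k)) = (\<Sum>v\<in>V. f v)" for f :: "'a \<Rightarrow> real"
    using sum_nth_distinct[OF vs(1)] vs(2) n by simp
  have QP: "Q * P = 1\<^sub>m n"
  proof (rule eq_matI)
    fix i j assume "i < dim_row (1\<^sub>m n :: real mat)" "j < dim_col (1\<^sub>m n :: real mat)"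
    then have ij: "i < n" "j < n" by auto
    then have "(Q * P) $$ (i, j) = (\<Sum>k\<in>{0..<n}. e i (vs ! k) * e j (vs ! k))"
      by (simp add: Q_def P_def scalar_prod_def)
    also have "\<dots> = ip V (e i) (e j)"
      unfolding ip_def by (rule sum_vs)
    finally show "(Q * P) $$ (i, j) = 1\<^sub>m n $$ (i, j)"
      using ij orth by simp
  qed (auto simp: Q_def P_def)
  have PQ: "P * Q = 1\<^sub>m n"
    by (rule mat_mult_left_right_inverse[OF carrier(3,2) QP])
  have AP: "A * P = P * D"
  proof (rule eq_matI)
    fix i j assume "i < dim_row (P * D)" "j < dim_col (P * D)"
    then have ij: "i < n" "j < n"
      using carrier by auto
    then have "(A * P) $$ (i, j) = (\<Sum>k\<in>{0..<n}. K (vs ! i) (vs ! k) * e j (vs ! k))"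
      by (simp add: A_def P_def scalar_prod_def)
    also have "\<dots> = kernel_app V K (e j) (vs ! i)"
      unfolding kernel_app_def by (rule sum_vs)
    also have "\<dots> = e j (vs ! i) * l j"
      using eig ij vs n by (auto simp: mult.commute)
    also have "\<dots> = (P * D) $$ (i, j)"
      using ij unfolding D_def mat_diag_mult_right[OF carrier(2)] by (simp add: P_def)
    finally show "(A * P) $$ (i, j) = (P * D) $$ (i, j)" .
  qed (use carrier in auto)
  have "A = A * (P * Q)"
    using carrier PQ by simp
  also have "\<dots> = P * D * Q"
    using carrier AP by (simp flip: assoc_mult_mat)
  finally have "similar_mat A D"
    using carrier PQ QP by (intro similar_matI[of _ _ P Q n]) auto
  then have "char_poly A = char_poly D"
    by (rule char_poly_similar)
  also have "\<dots> = (\<Prod>a\<leftarrow>diag_mat D. [:- a, 1:])"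
    by (rule char_poly_upper_triangular[OF carrier(4)]) (auto simp: D_def mat_diag_def)
  also have "diag_mat D = map l [0..<n]"
    by (auto simp: diag_mat_def D_def mat_diag_def)
  finally show ?thesis
    by (simp add: A_def)
qed

section \<open>The Laplacian form and the two largest eigenvalues\<close>

text \<open>The quadratic form of the Laplacian. The double sum meets each edge as two ordered
  pairs, hence the division by 2.\<close>

definition dirichlet :: "'a set \<Rightarrow> ('a \<times> 'a) set \<Rightarrow> ('a \<Rightarrow> real) \<Rightarrow> real" where
  "dirichlet V E x = (\<Sum>v\<in>V. \<Sum>w\<in>V. of_bool ((v, w) \<in> E) * (x v - x w)\<^sup>2) / 2"

definition laplacian_kernel :: "('a, 'b) pre_digraph \<Rightarrow> 'a \<Rightarrow> 'a \<Rightarrow> real" where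
  "laplacian_kernel G v w =
     (if v = w then real (out_degree G v) else 0) - of_bool ((v, w) \<in> arcs_ends G)"

lemma laplacian_mat_eq_kernel:
  assumes "distinct vs"
  shows "laplacian_mat G vs =
    mat (length vs) (length vs) (\<lambda>(i, j). laplacian_kernel G (vs ! i) (vs ! j))"
  by (rule eq_matI)
    (use assms in \<open>auto simp: laplacian_mat_def degree_mat_def adjacency_mat_def mat_diag_def
      laplacian_kernel_def nth_eq_iff_index_eq\<close>)

text \<open>Without parallel arcs, \<open>head G\<close> is injective on the arcs leaving
  \<open>v\<close>.\<close>

lemma (in digraph) out_degree_eq_card:
  "out_degree G v = card {w \<in> verts G. (v, w) \<in> arcs_ends G}"
proof -
  have "inj_on (head G) (out_arcs G v)"
    using no_multi_arcs by (auto simp: inj_on_def arc_to_ends_def)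
  moreover have "head G ` out_arcs G v = {w \<in> verts G. (v, w) \<in> arcs_ends G}"
    by (auto simp: arcs_ends_conv)
  ultimately show ?thesis
    unfolding out_degree_def by (metis card_image)
qed

lemma (in graph) laplacian_kernel_commute: "laplacian_kernel G v w = laplacian_kernel G w v"
  using arcs_ends_symmetric[OF sym_arcs] by (auto simp: laplacian_kernel_def)

text \<open>At \<open>v\<close> the Laplacian sums \<open>x v - x w\<close> over the neighbours
  \<open>w\<close>. Exchanging \<open>v\<close> and \<open>w\<close> gives a second expression for
  the form, and the two expressions add up to the squares.\<close>

lemma (in graph) laplacian_kernel_dirichlet:
  "ip (verts G) x (kernel_app (verts G) (laplacian_kernel G) x) = dirichlet (verts G) (arcs_ends G) x"
proof -
  let ?V = "verts G" and ?a = "\<lambda>v w. of_bool ((v, w) \<in> arcs_ends G) :: real"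
  have sym: "?a v w = ?a w v" for v w
    using arcs_ends_symmetric[OF sym_arcs] by auto
  have deg: "real (out_degree G v) = (\<Sum>w\<in>?V. ?a v w)" for v
    unfolding out_degree_eq_card by (simp add: Int_def)
  have app: "kernel_app ?V (laplacian_kernel G) x v = (\<Sum>w\<in>?V. ?a v w * (x v - x w))" if "v \<in> ?V" for v
  proof -
    have "kernel_app ?V (laplacian_kernel G) x v
        = (\<Sum>w\<in>?V. if v = w then real (out_degree G v) * x w else 0) - (\<Sum>w\<in>?V. ?a v w * x w)"
      unfolding kernel_app_def laplacian_kernel_def sum_subtractf[symmetric]
      by (intro sum.cong) (auto simp: algebra_simps)
    also have "(\<Sum>w\<in>?V. if v = w then real (out_degree G v) * x w else 0) = (\<Sum>w\<in>?V. ?a v w) * x v"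
      using that by (simp add: deg)
    finally show ?thesis
      by (simp add: sum_distrib_right sum_subtractf algebra_simps)
  qed
  define S where "S = (\<Sum>v\<in>?V. \<Sum>w\<in>?V. ?a v w * (x v * x v - x v * x w))"
  have "ip ?V x (kernel_app ?V (laplacian_kernel G) x) = S"
    unfolding ip_def S_def by (intro sum.cong refl) (simp add: app sum_distrib_left algebra_simps)
  moreover have "S = (\<Sum>v\<in>?V. \<Sum>w\<in>?V. ?a v w * (x w * x w - x v * x w))"
    unfolding S_def by (subst sum.swap) (simp add: sym mult.commute[of "x _" "x _"])
  moreover have "(\<Sum>v\<in>?V. \<Sum>w\<in>?V. ?a v w * (x v - x w)\<^sup>2)
      = S + (\<Sum>v\<in>?V. \<Sum>w\<in>?V. ?a v w * (x w * x w - x v * x w))"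
    by (simp add: S_def sum.distrib[symmetric] power2_eq_square algebra_simps)
  ultimately show ?thesis
    unfolding dirichlet_def by linarith
qed

text \<open>Connects the roots of the characteristic polynomial with an eigenbasis. As
  \<open>l\<close> is decreasing, the reversed sorted list of roots is \<open>l\<close> itself, with
  index \<open>k\<close> for the eigenvalue number \<open>Suc k\<close>.\<close>

lemma (in graph) laplacian_spectrum:
  assumes vs: "distinct vs" "set vs = verts G"
  obtains e l where
    "\<And>i j. i < length vs \<Longrightarrow> j < length vs \<Longrightarrow> ip (verts G) (e i) (e j) = (if i = j then 1 else 0)"
    "\<And>i j. j < length vs \<Longrightarrow> i \<le> j \<Longrightarrow> l j \<le> l i"
    "\<And>k. k < length vs \<Longrightarrow> laplacian_eigenvalue G vs (Suc k) = l k"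
    "\<And>x. dirichlet (verts G) (arcs_ends G) x = (\<Sum>i<length vs. l i * (ip (verts G) x (e i))\<^sup>2)"
proof -
  let ?V = "verts G" and ?K = "laplacian_kernel G"
  have card: "card ?V = length vs"
    using vs distinct_card by metis
  obtain e l where e: "\<And>i j. i < length vs \<Longrightarrow> j < length vs \<Longrightarrow> ip ?V (e i) (e j) = (if i = j then 1 else 0)"
    "\<And>i v. i < length vs \<Longrightarrow> v \<in> ?V \<Longrightarrow> kernel_app ?V ?K (e i) v = l i * e i v"
    "\<And>i j. j < length vs \<Longrightarrow> i \<le> j \<Longrightarrow> l j \<le> l i"
    by (rule spectral_theorem[where V = ?V and K = ?K, OF finite_verts laplacian_kernel_commute, unfolded card])
      (rule that; assumption)
  have "sorted (rev (map l [0..<length vs]))"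
    by (auto simp: sorted_wrt_iff_nth_less rev_nth intro!: e)
  then have "sorted_list_of_multiset (mset (map l [0..<length vs])) = rev (map l [0..<length vs])"
    by (metis mset_rev sorted_list_of_multiset_mset sorted_sort_id)
  moreover have "char_poly (laplacian_mat G vs) = (\<Prod>a\<leftarrow>map l [0..<length vs]. [:- a, 1:])"
    unfolding laplacian_mat_eq_kernel[OF vs(1)]
    by (rule char_poly_orthonormal_eigenvectors[where e = e, OF vs refl e(1,2)])
  ultimately have lam: "laplacian_eigenvalue G vs (Suc k) = l k" if "k < length vs" for k
    using that by (simp only: laplacian_eigenvalue_def proots_prod_linear_factors) simp
  have q: "dirichlet ?V (arcs_ends G) x = (\<Sum>i<length vs. l i * (ip ?V x (e i))\<^sup>2)" for x
  proof -
    have "dirichlet ?V (arcs_ends G) x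
        = (\<Sum>i<length vs. ip ?V x (e i) * ip ?V (kernel_app ?V ?K x) (e i))"
      unfolding laplacian_kernel_dirichlet[symmetric]
      by (rule parseval[of ?V e, unfolded card]) (simp_all add: e)
    also have "\<dots> = (\<Sum>i<length vs. l i * (ip ?V x (e i))\<^sup>2)"
    proof (intro sum.cong refl)
      fix i assume i: "i \<in> {..<length vs}"
      have "ip ?V (kernel_app ?V ?K x) (e i) = ip ?V x (kernel_app ?V ?K (e i))"
        by (subst ip_commute) (rule ip_kernel_app_commute, rule laplacian_kernel_commute)
      also have "\<dots> = ip ?V x (\<lambda>v. l i * e i v)"
        using i by (intro ip_cong) (simp_all add: e)
      finally show "ip ?V x (e i) * ip ?V (kernel_app ?V ?K x) (e i) = l i * (ip ?V x (e i))\<^sup>2"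
        by (simp add: ip_linear power2_eq_square)
    qed
    finally show ?thesis .
  qed
  show thesis
    by (rule that[of e l]) (simp_all only: e lam q)
qed

section \<open>Ky Fan's principle for two eigenvalues\<close>

text \<open>After subtracting \<open>l 1\<close> from all \<open>l i\<close>, only the term for
  \<open>i = 0\<close> can be positive, and it is at most \<open>l 0 - l 1\<close>. The total weight
  2 restores \<open>2 * l 1\<close>.\<close>

lemma sum_weighted_le_two_largest:
  fixes l c :: "nat \<Rightarrow> real"
  assumes n: "2 \<le> n" and l: "\<And>i j. j < n \<Longrightarrow> i \<le> j \<Longrightarrow> l j \<le> l i"
    and c: "\<And>i. i < n \<Longrightarrow> 0 \<le> c i" "\<And>i. i < n \<Longrightarrow> c i \<le> 1" and sum: "(\<Sum>i<n. c i) = 2"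
  shows "(\<Sum>i<n. l i * c i) \<le> l 0 + l 1"
proof -
  have n': "{..<n} = insert 0 (insert 1 {2..<n})"
    using n by auto
  have "(\<Sum>i<n. (l i - l 1) * c i) \<le> (\<Sum>i<n. if i = 0 then l 0 - l 1 else 0)"
  proof (rule sum_mono)
    fix i assume i: "i \<in> {..<n}"
    show "(l i - l 1) * c i \<le> (if i = 0 then l 0 - l 1 else 0)"
    proof (cases "i = 0")
      case True
      then show ?thesis
        using c[of 0] l[of 1 0] n mult_left_le[of "c 0" "l 0 - l 1"] by simp
    next
      case False
      then show ?thesis
        using c(1)[of i] l[of i 1] i by (simp add: mult_nonpos_nonneg)
    qed
  qed
  also have "\<dots> = l 0 - l 1"
    using n by simp
  finally show ?thesis
    using sum by (simp add: left_diff_distrib sum_subtractf flip: sum_distrib_left)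
qed

lemma sum_list_sum_swap: "(\<Sum>p\<leftarrow>W. \<Sum>i\<in>I. f p i) = (\<Sum>i\<in>I. \<Sum>p\<leftarrow>W. f p i)" for f :: "_ \<Rightarrow> _ \<Rightarrow> real"
  by (induction W) (auto simp: sum.distrib)

text \<open>A weighted list \<open>W\<close> stands for the matrix \<open>M = \<Sum>(w, f)\<leftarrow>W. w f f\<^sup>T\<close>; weights may be negative. The
  assumptions say \<open>tr M = 2\<close> and \<open>0 \<le> M \<le> I\<close>.\<close>

lemma (in graph) weighted_dirichlet_le_two_largest:
  assumes vs: "distinct vs" "set vs = verts G" "2 \<le> length vs"
    and trace: "(\<Sum>(w, f)\<leftarrow>W. w * ip (verts G) f f) = 2"
    and nonneg: "\<And>z. 0 \<le> (\<Sum>(w, f)\<leftarrow>W. w * (ip (verts G) f z)\<^sup>2)"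
    and le: "\<And>z. (\<Sum>(w, f)\<leftarrow>W. w * (ip (verts G) f z)\<^sup>2) \<le> ip (verts G) z z"
  shows "(\<Sum>(w, f)\<leftarrow>W. w * dirichlet (verts G) (arcs_ends G) f)
    \<le> laplacian_eigenvalue G vs 1 + laplacian_eigenvalue G vs 2"
proof -
  let ?V = "verts G" and ?n = "length vs"
  have n0: "0 < ?n" "Suc 0 < ?n"
    using vs(3) by auto
  have card: "card ?V = ?n"
    using vs distinct_card by metis
  obtain e l where e: "\<And>i j. i < ?n \<Longrightarrow> j < ?n \<Longrightarrow> ip ?V (e i) (e j) = (if i = j then 1 else 0)"
    and l: "\<And>i j. j < ?n \<Longrightarrow> i \<le> j \<Longrightarrow> l j \<le> l i"
    and lam: "\<And>k. k < ?n \<Longrightarrow> laplacian_eigenvalue G vs (Suc k) = l k"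
    and q: "\<And>x. dirichlet ?V (arcs_ends G) x = (\<Sum>i<?n. l i * (ip ?V x (e i))\<^sup>2)"
    by (rule laplacian_spectrum[OF vs(1,2)]) (rule that; assumption)
  \<comment> \<open>These are the diagonal entries of \<open>M\<close> in the eigenbasis. They lie
    between 0 and 1, and by Parseval they sum to the trace.\<close>
  define c where "c i = (\<Sum>(w, f)\<leftarrow>W. w * (ip ?V f (e i))\<^sup>2)" for i
  have "(\<Sum>i<?n. c i) = (\<Sum>(w, f)\<leftarrow>W. w * (\<Sum>i<?n. (ip ?V f (e i))\<^sup>2))"
    unfolding c_def case_prod_unfold by (simp add: sum_list_sum_swap sum_distrib_left)
  also have "\<dots> = (\<Sum>(w, f)\<leftarrow>W. w * ip ?V f f)"
    by (subst parseval[of ?V e, unfolded card]) (simp_all add: e power2_eq_square)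
  finally have "(\<Sum>i<?n. c i) = 2"
    using trace by simp
  moreover have "0 \<le> c i" "c i \<le> 1" if "i < ?n" for i
    using nonneg[of "e i"] le[of "e i"] that e by (auto simp: c_def)
  ultimately have "(\<Sum>i<?n. l i * c i) \<le> l 0 + l 1"
    using l vs(3) by (intro sum_weighted_le_two_largest) auto
  moreover have "(\<Sum>(w, f)\<leftarrow>W. w * dirichlet ?V (arcs_ends G) f) = (\<Sum>i<?n. l i * c i)"
    unfolding c_def q case_prod_unfold
    by (simp add: sum_distrib_left sum_list_sum_swap mult.left_commute flip: sum_list_const_mult)
  moreover have "laplacian_eigenvalue G vs 1 = l 0" "laplacian_eigenvalue G vs 2 = l 1"
    using lam[of 0] lam[of 1] vs(3) n0 by (simp_all add: numeral_2_eq_2)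
  ultimately show ?thesis by simp
qed

text \<open>The first two eigenvectors. Their orthogonality is recorded as Bessel's inequality, the
  form in which the upper bound for the star uses it.\<close>

lemma (in graph) two_largest_attained:
  assumes vs: "distinct vs" "set vs = verts G" "2 \<le> length vs"
  obtains x y where "ip (verts G) x x = 1" "ip (verts G) y y = 1"
    "laplacian_eigenvalue G vs 1 = dirichlet (verts G) (arcs_ends G) x"
    "laplacian_eigenvalue G vs 2 = dirichlet (verts G) (arcs_ends G) y"
    "\<And>h. (ip (verts G) x h)\<^sup>2 + (ip (verts G) y h)\<^sup>2 \<le> ip (verts G) h h"
proof -
  let ?V = "verts G" and ?n = "length vs"
  have n0: "0 < ?n" "Suc 0 < ?n"
    using vs(3) by auto
  have card: "card ?V = ?n"
    using vs distinct_card by metis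
  obtain e l where e: "\<And>i j. i < ?n \<Longrightarrow> j < ?n \<Longrightarrow> ip ?V (e i) (e j) = (if i = j then 1 else 0)"
    and l: "\<And>i j. j < ?n \<Longrightarrow> i \<le> j \<Longrightarrow> l j \<le> l i"
    and lam: "\<And>k. k < ?n \<Longrightarrow> laplacian_eigenvalue G vs (Suc k) = l k"
    and q: "\<And>x. dirichlet ?V (arcs_ends G) x = (\<Sum>i<?n. l i * (ip ?V x (e i))\<^sup>2)"
    by (rule laplacian_spectrum[OF vs(1,2)]) (rule that; assumption)
  have "dirichlet ?V (arcs_ends G) (e k) = l k" if "k < ?n" for k
  proof -
    have "dirichlet ?V (arcs_ends G) (e k) = (\<Sum>i<?n. if i = k then l i else 0)"
      unfolding q using that by (intro sum.cong) (auto simp: e)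
    then show ?thesis using that by simp
  qed
  moreover have "(ip ?V (e 0) h)\<^sup>2 + (ip ?V (e 1) h)\<^sup>2 \<le> ip ?V h h" for h
  proof -
    have "(\<Sum>i\<in>{0,1}. (ip ?V h (e i))\<^sup>2) \<le> (\<Sum>i<?n. (ip ?V h (e i))\<^sup>2)"
      using vs(3) by (intro sum_mono2) auto
    also have "\<dots> = ip ?V h h"
      by (subst (2) parseval[of ?V e, unfolded card]) (simp_all add: e power2_eq_square)
    finally show ?thesis
      by (simp add: ip_commute)
  qed
  ultimately show thesis
    using lam[of 0] lam[of 1] vs(3) n0 e(1)[of 0 0] e(1)[of 1 1]
    by (intro that[of "e 0" "e 1"]) (simp_all add: numeral_2_eq_2)
qed

section \<open>Test vectors constant on four blocks\<close>

definition edge_count :: "('a \<times> 'a) set \<Rightarrow> 'a set \<Rightarrow> 'a set \<Rightarrow> real" where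
  "edge_count E S T = (\<Sum>x\<in>S. \<Sum>y\<in>T. of_bool ((x, y) \<in> E))"

text \<open>The default value \<open>d\<close> is the value on the fourth block \<open>B\<close> of
  the partition below.\<close>

definition four_block :: "'a \<Rightarrow> 'a \<Rightarrow> 'a set \<Rightarrow> real \<Rightarrow> real \<Rightarrow> real \<Rightarrow> real \<Rightarrow> 'a \<Rightarrow> real" where
  "four_block u v A a b c d x = (if x = u then a else if x = v then b else if x \<in> A then c else d)"

lemma edge_count_nonneg: "0 \<le> edge_count E S T"
  by (simp add: edge_count_def sum_nonneg)

lemma edge_count_commute:
  assumes "\<And>x y. (x, y) \<in> E \<Longrightarrow> (y, x) \<in> E"
  shows "edge_count E S T = edge_count E T S"
proof -
  have "(x, y) \<in> E \<longleftrightarrow> (y, x) \<in> E" for x y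
    using assms by blast
  then show ?thesis
    unfolding edge_count_def by (subst sum.swap) simp
qed

lemma edge_count_singleton: "finite T \<Longrightarrow> edge_count E {x} T = card {y \<in> T. (x, y) \<in> E}"
  by (simp add: edge_count_def Int_def)

lemma edge_count_singletons: "edge_count E {x} {y} = of_bool ((x, y) \<in> E)"
  by (simp add: edge_count_def)

lemma edge_count_pos:
  assumes "finite S" "finite T" "x \<in> S" "y \<in> T" "(x, y) \<in> E"
  shows "0 < edge_count E S T"
proof -
  have "0 < (\<Sum>y\<in>T. of_bool ((x, y) \<in> E) :: real)"
    using assms by (intro sum_pos2[of _ y]) auto
  then show ?thesis
    unfolding edge_count_def by (rule sum_pos2[OF assms(1,3)]) (rule sum_nonneg, simp)
qed

text \<open>The partition is used with two choices of blocks: \<open>A\<close> the neighbours of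
  \<open>u\<close> or \<open>v\<close> and \<open>B\<close> the rest, which may be empty; later
  \<open>A\<close> and \<open>B\<close> the private neighbours of \<open>u\<close> and of
  \<open>v\<close>.\<close>

locale four_blocks =
  fixes V :: "'a set" and E :: "('a \<times> 'a) set" and u v :: 'a and A B :: "'a set"
  assumes fin: "finite V"
    and V: "V = {u} \<union> {v} \<union> A \<union> B"
    and disjoint: "u \<noteq> v" "u \<notin> A" "u \<notin> B" "v \<notin> A" "v \<notin> B" "A \<inter> B = {}"
    and sym: "\<And>x y. (x, y) \<in> E \<Longrightarrow> (y, x) \<in> E"
begin

abbreviation block :: "real \<Rightarrow> real \<Rightarrow> real \<Rightarrow> real \<Rightarrow> 'a \<Rightarrow> real" where
  "block \<equiv> four_block u v A"

lemma finite_blocks: "finite A" "finite B"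
  using fin V by auto

lemma sum_blocks: "(\<Sum>x\<in>V. f x) = f u + f v + (\<Sum>x\<in>A. f x) + (\<Sum>x\<in>B. f x)" for f :: "'a \<Rightarrow> real"
  using disjoint finite_blocks unfolding V by (subst sum.union_disjoint | simp)+

lemma block_simps:
  "block a b c d u = a" "block a b c d v = b"
  "x \<in> A \<Longrightarrow> block a b c d x = c" "x \<in> B \<Longrightarrow> block a b c d x = d"
  using disjoint by (auto simp: four_block_def)

lemma ip_block: "ip V (block a b c d) z = a * z u + b * z v + c * sum z A + d * sum z B"
  unfolding ip_def sum_blocks by (simp add: block_simps sum_distrib_left)

lemma ip_block_block:
  "ip V (block a b c d) (block a b c d) = a\<^sup>2 + b\<^sup>2 + c\<^sup>2 * card A + d\<^sup>2 * card B"
  unfolding ip_block by (simp add: block_simps power2_eq_square)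

text \<open>Edges inside a block contribute nothing. Each of the six pairs of distinct blocks occurs
  twice in the double sum, which cancels the factor 1/2.\<close>

lemma dirichlet_block:
  "dirichlet V E (block a b c d) =
    (a - b)\<^sup>2 * edge_count E {u} {v} + (a - c)\<^sup>2 * edge_count E {u} A + (a - d)\<^sup>2 * edge_count E {u} B
    + (b - c)\<^sup>2 * edge_count E {v} A + (b - d)\<^sup>2 * edge_count E {v} B + (c - d)\<^sup>2 * edge_count E A B"
proof -
  define h where "h S T = (\<Sum>x\<in>S. \<Sum>y\<in>T. of_bool ((x, y) \<in> E) * (block a b c d x - block a b c d y)\<^sup>2)" for S T
  have h: "h S T = (s - t)\<^sup>2 * edge_count E S T"
    if "\<And>x. x \<in> S \<Longrightarrow> block a b c d x = s" "\<And>x. x \<in> T \<Longrightarrow> block a b c d x = t" for S T s t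
    using that by (simp add: h_def edge_count_def sum_distrib_left mult.commute)
  have expand: "2 * dirichlet V E (block a b c d)
      = (h {u} {u} + h {u} {v} + h {u} A + h {u} B) + (h {v} {u} + h {v} {v} + h {v} A + h {v} B)
        + (h A {u} + h A {v} + h A A + h A B) + (h B {u} + h B {v} + h B A + h B B)"
    unfolding dirichlet_def sum_blocks h_def
    by (simp add: sum.distrib del: sum_of_bool_mult_eq)
  have diag: "h {u} {u} = 0" "h {v} {v} = 0" "h A A = 0" "h B B = 0"
    using h[of "{u}" a "{u}" a] h[of "{v}" b "{v}" b] h[of A c A c] h[of B d B d]
    by (simp_all add: block_simps)
  have off_diag:
    "h {u} {v} = (a - b)\<^sup>2 * edge_count E {u} {v}"
    "h {u} A = (a - c)\<^sup>2 * edge_count E {u} A"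
    "h {u} B = (a - d)\<^sup>2 * edge_count E {u} B"
    "h {v} A = (b - c)\<^sup>2 * edge_count E {v} A"
    "h {v} B = (b - d)\<^sup>2 * edge_count E {v} B"
    "h A B = (c - d)\<^sup>2 * edge_count E A B"
    "h {v} {u} = (b - a)\<^sup>2 * edge_count E {v} {u}"
    "h A {u} = (c - a)\<^sup>2 * edge_count E A {u}"
    "h B {u} = (d - a)\<^sup>2 * edge_count E B {u}"
    "h A {v} = (c - b)\<^sup>2 * edge_count E A {v}"
    "h B {v} = (d - b)\<^sup>2 * edge_count E B {v}"
    "h B A = (d - c)\<^sup>2 * edge_count E B A"
    by (rule h; simp add: block_simps)+
  have commute: "edge_count E {v} {u} = edge_count E {u} {v}" "edge_count E A {u} = edge_count E {u} A"
    "edge_count E B {u} = edge_count E {u} B" "edge_count E A {v} = edge_count E {v} A"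
    "edge_count E B {v} = edge_count E {v} B" "edge_count E B A = edge_count E A B"
    by (rule edge_count_commute, erule sym)+
  have squares: "(b - a)\<^sup>2 = (a - b)\<^sup>2" "(c - a)\<^sup>2 = (a - c)\<^sup>2" "(d - a)\<^sup>2 = (a - d)\<^sup>2"
    "(c - b)\<^sup>2 = (b - c)\<^sup>2" "(d - b)\<^sup>2 = (b - d)\<^sup>2" "(d - c)\<^sup>2 = (c - d)\<^sup>2"
    by (rule power2_commute)+
  show ?thesis
    using expand unfolding diag off_diag commute squares by (simp add: algebra_simps)
qed

lemma ip_self_blocks: "ip V z z = (z u)\<^sup>2 + (z v)\<^sup>2 + (\<Sum>x\<in>A. (z x)\<^sup>2) + (\<Sum>x\<in>B. (z x)\<^sup>2)"
  unfolding ip_def sum_blocks by (simp add: power2_eq_square)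

end

section \<open>Scalar inequalities behind the test matrices\<close>

text \<open>Cauchy-Schwarz against the indicator of \<open>A\<close>: projecting onto it does not
  increase the norm. If \<open>card A = 0\<close>, the quotient is 0 by convention.\<close>

lemma sum_squared_div_card_le: "(sum z A)\<^sup>2 / card A \<le> (\<Sum>x\<in>A. (z x)\<^sup>2)" for z :: "'a \<Rightarrow> real"
proof (cases "card A = 0")
  case False
  have "(\<Sum>x\<in>A. z x)\<^sup>2 \<le> (\<Sum>x\<in>A. 1\<^sup>2) * (\<Sum>x\<in>A. (z x)\<^sup>2)"
    using Cauchy_Schwarz_ineq_sum[of "\<lambda>_. 1" z A] by simp
  then show ?thesis
    using False by (simp add: divide_le_eq mult.commute)
qed (simp add: sum_nonneg)

text \<open>Cauchy-Schwarz for \<open>(1, 1, sqrt k)\<close> and \<open>(x, y, s / sqrt k)\<close>,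
  proved by Lagrange's identity multiplied by \<open>k\<close>. It makes the difference of the two
  projections positive semidefinite.\<close>

lemma sum_three_squares_div_le:
  fixes k :: real
  assumes "0 < k"
  shows "(x + y + s)\<^sup>2 / (k + 2) \<le> x\<^sup>2 + y\<^sup>2 + s\<^sup>2 / k"
proof -
  have "0 \<le> k * (x - y)\<^sup>2 + (k * x - s)\<^sup>2 + (k * y - s)\<^sup>2"
    using assms by simp
  also have "\<dots> = (k + 2) * (k * x\<^sup>2 + k * y\<^sup>2 + s\<^sup>2) - k * (x + y + s)\<^sup>2"
    by (simp add: power2_eq_square algebra_simps)
  finally show ?thesis
    using assms by (simp add: field_simps)
qed

text \<open>Bessel's inequality for \<open>(1, 1, \<surd>p, \<surd>q)\<close> and \<open>(\<delta>, -\<delta>, 1/\<surd>p, -1/\<surd>q)\<close>, which are orthogonal.\<close>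

lemma bessel_two_blocks:
  fixes p q \<delta> :: real
  assumes p: "0 < p" and q: "0 < q"
  defines "Y \<equiv> 2 * \<delta>\<^sup>2 + 1 / p + 1 / q"
  shows "(x + y + s + t)\<^sup>2 / (p + q + 2) + (\<delta> * x - \<delta> * y + s / p - t / q)\<^sup>2 / Y
    \<le> x\<^sup>2 + y\<^sup>2 + s\<^sup>2 / p + t\<^sup>2 / q"
proof -
  \<comment> \<open>The coefficients of the orthogonal projection onto the two vectors. The
    inequality states that the residual has a nonnegative squared norm.\<close>
  define \<alpha> where "\<alpha> = (x + y + s + t) / (p + q + 2)"
  define r where "r = \<delta> * x - \<delta> * y + s / p - t / q"
  define \<beta> where "\<beta> = r / Y"
  have Y: "0 < Y"
    unfolding Y_def using p q by (intro add_nonneg_pos add_pos_pos add_nonneg_nonneg) auto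
  have 1: "p * (s / p - \<alpha> - \<beta> / p)\<^sup>2 = s\<^sup>2 / p - 2 * \<alpha> * s - 2 * \<beta> * (s / p) + \<alpha>\<^sup>2 * p + 2 * \<alpha> * \<beta> + \<beta>\<^sup>2 / p"
    using p by (simp add: power2_eq_square field_simps)
  have 2: "q * (t / q - \<alpha> + \<beta> / q)\<^sup>2 = t\<^sup>2 / q - 2 * \<alpha> * t + 2 * \<beta> * (t / q) + \<alpha>\<^sup>2 * q - 2 * \<alpha> * \<beta> + \<beta>\<^sup>2 / q"
    using q by (simp add: power2_eq_square field_simps)
  have "0 \<le> (x - \<alpha> - \<beta> * \<delta>)\<^sup>2 + (y - \<alpha> + \<beta> * \<delta>)\<^sup>2
      + p * (s / p - \<alpha> - \<beta> / p)\<^sup>2 + q * (t / q - \<alpha> + \<beta> / q)\<^sup>2"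
    using p q by simp
  also have "\<dots> = x\<^sup>2 + y\<^sup>2 + s\<^sup>2 / p + t\<^sup>2 / q - 2 * \<alpha> * (x + y + s + t) - 2 * \<beta> * r
      + \<alpha>\<^sup>2 * (p + q + 2) + \<beta>\<^sup>2 * Y"
    unfolding 1 2 r_def Y_def by (simp add: power2_eq_square algebra_simps)
  also have "\<alpha>\<^sup>2 * (p + q + 2) = \<alpha> * (x + y + s + t)"
    using p q by (simp add: \<alpha>_def power2_eq_square)
  also have "\<beta>\<^sup>2 * Y = \<beta> * r"
    using Y by (simp add: \<beta>_def power2_eq_square)
  finally have "\<alpha> * (x + y + s + t) + \<beta> * r \<le> x\<^sup>2 + y\<^sup>2 + s\<^sup>2 / p + t\<^sup>2 / q"
    by simp
  then show ?thesis
    by (simp add: \<alpha>_def \<beta>_def r_def power2_eq_square)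
qed

text \<open>The left side is the Dirichlet form of the vector \<open>y\<close>, the first factor on
  the right its squared norm. Put \<open>s = 1 / p + 1 / q\<close>. For \<open>\<delta> = 0\<close>
  both sides equal \<open>s * (1 + m * s)\<close>; the left side has the linear term
  \<open>- 4 * \<delta>\<close>, the right side none. The chosen \<open>\<delta>\<close> is small
  enough for this term to outweigh the quadratic ones on the left.\<close>

lemma two_block_dirichlet_less:
  fixes p q m \<epsilon> :: real
  assumes p: "0 < p" and q: "0 < q" and m: "0 \<le> m" and \<epsilon>: "\<epsilon> \<le> 1"
  defines "\<delta> \<equiv> 1 / (p + q + 2)"
  shows "(2 * \<delta>)\<^sup>2 * \<epsilon> + (\<delta> - 1 / p)\<^sup>2 * p + (1 / q - \<delta>)\<^sup>2 * q + (1 / p + 1 / q)\<^sup>2 * m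
    < (2 * \<delta>\<^sup>2 + 1 / p + 1 / q) * (1 + m / p + m / q)"
proof -
  define s where "s = 1 / p + 1 / q"
  have s: "0 < s"
    unfolding s_def using p q by (intro add_pos_pos) auto
  have \<delta>: "0 < \<delta>" "\<delta> * (p + q + 2) = 1"
    using p q by (auto simp: \<delta>_def)
  have "2 * \<delta> \<le> \<delta> * (p + q + 2)"
    using \<delta>(1) p q by (simp add: distrib_left)
  then have "2 * \<delta> \<le> 1"
    using \<delta> by simp
  have "4 * \<delta> * \<epsilon> \<le> 4 * \<delta>"
    using \<delta> \<epsilon> by simp
  then have "4 * \<delta> * \<epsilon> + \<delta> * (p + q) - 4 < 0"
    using \<delta>(2) \<open>2 * \<delta> \<le> 1\<close> by (simp add: distrib_left)
  then have "\<delta> * (4 * \<delta> * \<epsilon> + \<delta> * (p + q) - 4) < 0"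
    using \<delta> by (simp add: mult_pos_neg)
  also have "0 \<le> 2 * \<delta>\<^sup>2 * (1 + m * s)"
    using m s by simp
  finally have "\<delta> * (4 * \<delta> * \<epsilon> + \<delta> * (p + q) - 4) + s + m * s\<^sup>2 < (2 * \<delta>\<^sup>2 + s) * (1 + m * s)"
    by (simp add: algebra_simps power2_eq_square)
  moreover have "(\<delta> - 1 / p)\<^sup>2 * p = \<delta>\<^sup>2 * p - 2 * \<delta> + 1 / p" "(1 / q - \<delta>)\<^sup>2 * q = \<delta>\<^sup>2 * q - 2 * \<delta> + 1 / q"
    using p q by (simp_all add: power2_eq_square field_simps)
  ultimately show ?thesis
    by (simp add: s_def power2_eq_square algebra_simps)
qed

section \<open>Lower bounds from the two test matrices\<close>

context graph
begin

lemma degree_blocks: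
  assumes "four_blocks (verts G) (arcs_ends G) u v A B"
  shows "real (out_degree G u) = edge_count (arcs_ends G) {u} {v} + edge_count (arcs_ends G) {u} A + edge_count (arcs_ends G) {u} B"
    and "real (out_degree G v) = edge_count (arcs_ends G) {u} {v} + edge_count (arcs_ends G) {v} A + edge_count (arcs_ends G) {v} B"
proof -
  interpret four_blocks "verts G" "arcs_ends G" u v A B
    by (rule assms)
  have deg: "real (out_degree G x) = (\<Sum>y\<in>verts G. of_bool ((x, y) \<in> arcs_ends G))" for x
    unfolding out_degree_eq_card by (simp add: Int_def)
  have *: "(v, u) \<in> arcs_ends G \<longleftrightarrow> (u, v) \<in> arcs_ends G" "(u, u) \<notin> arcs_ends G" "(v, v) \<notin> arcs_ends G"
    using sym adj_not_same by blast+
  show "real (out_degree G u) = edge_count (arcs_ends G) {u} {v} + edge_count (arcs_ends G) {u} A + edge_count (arcs_ends G) {u} B"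
    "real (out_degree G v) = edge_count (arcs_ends G) {u} {v} + edge_count (arcs_ends G) {v} A + edge_count (arcs_ends G) {v} B"
    unfolding deg sum_blocks using * by (simp_all add: edge_count_def)
qed

text \<open>An indicator vector has as Dirichlet form the number of edges leaving its set. So
  \<open>u\<close> and \<open>v\<close> contribute their degrees, \<open>A\<close> its boundary
  divided by \<open>k\<close>, and the removed vector only the edges from \<open>A\<close> to
  \<open>B\<close>. The trace is 3 - 1.\<close>

lemma two_largest_ge_neighbourhood:
  fixes u v A B
  assumes vs: "distinct vs" "set vs = verts G" "2 \<le> length vs"
    and blocks: "four_blocks (verts G) (arcs_ends G) u v A B"
    and "A \<noteq> {}"
    and B: "edge_count (arcs_ends G) {u} B = 0" "edge_count (arcs_ends G) {v} B = 0"
  defines "e \<equiv> edge_count (arcs_ends G)"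
  defines "k \<equiv> real (card A)"
  shows "real (out_degree G u) + real (out_degree G v) + (e {u} A + e {v} A + e A B) / k - e A B / (k + 2)
    \<le> laplacian_eigenvalue G vs 1 + laplacian_eigenvalue G vs 2"
proof -
  interpret four_blocks "verts G" "arcs_ends G" u v A B
    by (rule blocks)
  have k: "0 < k"
    using \<open>A \<noteq> {}\<close> finite_blocks by (simp add: k_def card_gt_0_iff)
  define W where "W = [(1, block 1 0 0 0), (1, block 0 1 0 0), (1 / k, block 0 0 1 0),
    (- (1 / (k + 2)), block 1 1 1 0)]"
  have "(\<Sum>(w, f)\<leftarrow>W. w * dirichlet (verts G) (arcs_ends G) f)
    \<le> laplacian_eigenvalue G vs 1 + laplacian_eigenvalue G vs 2"
  proof (rule weighted_dirichlet_le_two_largest[OF vs])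
    show "(\<Sum>(w, f)\<leftarrow>W. w * ip (verts G) f f) = 2"
      using k by (simp add: W_def ip_block_block flip: k_def)
  next
    fix z
    have W: "(\<Sum>(w, f)\<leftarrow>W. w * (ip (verts G) f z)\<^sup>2)
        = (z u)\<^sup>2 + (z v)\<^sup>2 + (sum z A)\<^sup>2 / k - (z u + z v + sum z A)\<^sup>2 / (k + 2)"
      by (simp add: W_def ip_block)
    show "0 \<le> (\<Sum>(w, f)\<leftarrow>W. w * (ip (verts G) f z)\<^sup>2)"
      unfolding W using sum_three_squares_div_le[OF k] by simp
    have "0 \<le> (z u + z v + sum z A)\<^sup>2 / (k + 2)" "0 \<le> (\<Sum>x\<in>B. (z x)\<^sup>2)"
      using k by (auto intro: sum_nonneg)
    then show "(\<Sum>(w, f)\<leftarrow>W. w * (ip (verts G) f z)\<^sup>2) \<le> ip (verts G) z z"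
      unfolding W ip_self_blocks using sum_squared_div_card_le[of z A, folded k_def] by linarith
  qed
  also have "(\<Sum>(w, f)\<leftarrow>W. w * dirichlet (verts G) (arcs_ends G) f)
      = real (out_degree G u) + real (out_degree G v) + (e {u} A + e {v} A + e A B) / k - e A B / (k + 2)"
    using B by (simp add: W_def dirichlet_block degree_blocks[OF blocks] e_def)
  finally show ?thesis .
qed

text \<open>Here the trace is 4 - 2. The indicators of \<open>A\<close> and \<open>B\<close>
  contribute \<open>1 + m / p\<close> and \<open>1 + m / q\<close>, and removing the constants costs
  nothing. Removing \<open>y\<close> costs its Rayleigh quotient \<open>D / Y\<close>, which is less
  than \<open>1 + m / p + m / q\<close>, so more than 1 remains beyond the degrees.\<close>

lemma two_largest_greater_double_star:
  fixes u v A B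
  assumes vs: "distinct vs" "set vs = verts G" "2 \<le> length vs"
    and blocks: "four_blocks (verts G) (arcs_ends G) u v A B"
    and ne: "A \<noteq> {}" "B \<noteq> {}"
    and uA: "edge_count (arcs_ends G) {u} A = card A" and uB: "edge_count (arcs_ends G) {u} B = 0"
    and vA: "edge_count (arcs_ends G) {v} A = 0" and vB: "edge_count (arcs_ends G) {v} B = card B"
  shows "real (out_degree G u) + real (out_degree G v) + 1
    < laplacian_eigenvalue G vs 1 + laplacian_eigenvalue G vs 2"
proof -
  interpret four_blocks "verts G" "arcs_ends G" u v A B
    by (rule blocks)
  define p q where "p = real (card A)" and "q = real (card B)"
  define \<epsilon> m where "\<epsilon> = edge_count (arcs_ends G) {u} {v}" and "m = edge_count (arcs_ends G) A B"
  define \<delta> where "\<delta> = 1 / (p + q + 2)"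
  define Y where "Y = 2 * \<delta>\<^sup>2 + 1 / p + 1 / q"
  have pq: "0 < p" "0 < q"
    using ne finite_blocks by (simp_all add: p_def q_def card_gt_0_iff)
  have Y: "0 < Y"
    unfolding Y_def using pq by (intro add_nonneg_pos add_pos_pos add_nonneg_nonneg) auto
  have \<epsilon>m: "\<epsilon> \<le> 1" "0 \<le> m"
    by (simp_all add: \<epsilon>_def m_def edge_count_singletons edge_count_nonneg)
  define D where "D = (2 * \<delta>)\<^sup>2 * \<epsilon> + (\<delta> - 1 / p)\<^sup>2 * p + (1 / q - \<delta>)\<^sup>2 * q + (1 / p + 1 / q)\<^sup>2 * m"
  define W where "W = [(1, block 1 0 0 0), (1, block 0 1 0 0), (1 / p, block 0 0 1 0), (1 / q, block 0 0 0 1),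
    (- (1 / (p + q + 2)), block 1 1 1 1), (- (1 / Y), block \<delta> (- \<delta>) (1 / p) (- (1 / q)))]"
  have "(\<Sum>(w, f)\<leftarrow>W. w * dirichlet (verts G) (arcs_ends G) f)
    \<le> laplacian_eigenvalue G vs 1 + laplacian_eigenvalue G vs 2"
  proof (rule weighted_dirichlet_le_two_largest[OF vs])
    have "(1 / p)\<^sup>2 * p = 1 / p" "(1 / q)\<^sup>2 * q = 1 / q"
      using pq by (auto simp: power2_eq_square)
    then have "ip (verts G) (block \<delta> (- \<delta>) (1 / p) (- (1 / q))) (block \<delta> (- \<delta>) (1 / p) (- (1 / q))) = Y"
      unfolding ip_block_block by (simp add: Y_def flip: p_def q_def)
    moreover have "ip (verts G) (block 1 1 1 1) (block 1 1 1 1) = p + q + 2"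
      unfolding ip_block_block by (simp add: p_def q_def)
    moreover have "1 / (p + q + 2) * (p + q + 2) = 1"
      using pq by simp
    ultimately show "(\<Sum>(w, f)\<leftarrow>W. w * ip (verts G) f f) = 2"
      using pq Y by (simp add: W_def ip_block_block flip: p_def q_def)
  next
    fix z
    have W: "(\<Sum>(w, f)\<leftarrow>W. w * (ip (verts G) f z)\<^sup>2)
        = (z u)\<^sup>2 + (z v)\<^sup>2 + (sum z A)\<^sup>2 / p + (sum z B)\<^sup>2 / q
          - ((z u + z v + sum z A + sum z B)\<^sup>2 / (p + q + 2)
             + (\<delta> * z u - \<delta> * z v + sum z A / p - sum z B / q)\<^sup>2 / Y)"
      by (simp add: W_def ip_block)
    show "0 \<le> (\<Sum>(w, f)\<leftarrow>W. w * (ip (verts G) f z)\<^sup>2)"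
      unfolding W using bessel_two_blocks[OF pq, of "z u" "z v" "sum z A" "sum z B" \<delta>, folded Y_def] by simp
    have "0 \<le> (z u + z v + sum z A + sum z B)\<^sup>2 / (p + q + 2)"
      "0 \<le> (\<delta> * z u - \<delta> * z v + sum z A / p - sum z B / q)\<^sup>2 / Y"
      using pq Y by auto
    then show "(\<Sum>(w, f)\<leftarrow>W. w * (ip (verts G) f z)\<^sup>2) \<le> ip (verts G) z z"
      unfolding W ip_self_blocks
      using sum_squared_div_card_le[of z A] sum_squared_div_card_le[of z B]
      unfolding p_def[symmetric] q_def[symmetric] by linarith
  qed
  also have "(\<Sum>(w, f)\<leftarrow>W. w * dirichlet (verts G) (arcs_ends G) f)
      = real (out_degree G u) + real (out_degree G v) + (1 + m / p) + (1 + m / q) - D / Y"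
  proof -
    have "dirichlet (verts G) (arcs_ends G) (block \<delta> (- \<delta>) (1 / p) (- (1 / q))) = D"
      unfolding dirichlet_block uA uB vA vB D_def
      by (simp add: power2_commute[of "- \<delta>"] flip: p_def q_def \<epsilon>_def m_def)
    then show ?thesis
      using pq by (simp add: W_def dirichlet_block degree_blocks[OF blocks] uA uB vA vB add_divide_distrib
          flip: p_def q_def \<epsilon>_def m_def)
  qed
  finally have "real (out_degree G u) + real (out_degree G v) + (1 + m / p) + (1 + m / q) - D / Y
    \<le> laplacian_eigenvalue G vs 1 + laplacian_eigenvalue G vs 2" .
  moreover have "D < Y * (1 + m / p + m / q)"
    unfolding D_def Y_def \<delta>_def by (rule two_block_dirichlet_less[OF pq \<epsilon>m(2,1)])
  then have "D / Y < 1 + m / p + m / q"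
    using Y by (simp add: divide_less_eq mult.commute)
  ultimately show ?thesis by linarith
qed

end

section \<open>Degrees and stars\<close>

text \<open>A set without outgoing edges contains everything reachable from it, and a connected
  symmetric digraph is strongly connected.\<close>

lemma (in graph) connected_cut:
  assumes "Digraph_Component.connected G" and S: "S \<subseteq> verts G" "S \<noteq> {}" "S \<noteq> verts G"
  shows "\<exists>x\<in>S. \<exists>y\<in>verts G - S. (x, y) \<in> arcs_ends G"
proof -
  have "strongly_connected G"
    using symmetric_connected_imp_strongly_connected sym_arcs assms(1) by blast
  moreover obtain s t where "s \<in> S" "t \<in> verts G - S"
    using S by blast
  ultimately have "s \<rightarrow>\<^sup>* t"
    using S by (auto simp: strongly_connected_def)
  then have "t \<in> S" if "\<And>x y. x \<in> S \<Longrightarrow> (x, y) \<in> arcs_ends G \<Longrightarrow> y \<in> S"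
    using \<open>s \<in> S\<close> that by (induction rule: reachable_induct) auto
  with \<open>t \<in> verts G - S\<close> show ?thesis
    using adj_in_verts by blast
qed

lemma (in graph) is_starI:
  assumes u: "u \<in> verts G" and n: "card (verts G) = n"
    and adj: "\<And>w. w \<in> verts G \<Longrightarrow> w \<noteq> u \<Longrightarrow> (u, w) \<in> arcs_ends G"
    and deg: "\<And>w. w \<in> verts G \<Longrightarrow> w \<noteq> u \<Longrightarrow> out_degree G w \<le> 1"
  shows "is_star n G"
proof -
  have "arcs_ends G \<subseteq> {u} \<times> (verts G - {u}) \<union> (verts G - {u}) \<times> {u}"
  proof (rule subrelI)
    fix x y assume xy: "(x, y) \<in> arcs_ends G"
    have V: "x \<in> verts G" "y \<in> verts G" and "x \<noteq> y"
      using xy adj_in_verts adj_not_same by blast+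
    have "x = u \<or> y = u"
    proof (rule ccontr)
      assume "\<not> (x = u \<or> y = u)"
      then have "x \<noteq> u" "y \<noteq> u"
        by auto
      \<comment> \<open>An edge avoiding \<open>u\<close> would give its endpoint \<open>x\<close>
        the two neighbours \<open>u\<close> and \<open>y\<close>.\<close>
      have "{u, y} \<subseteq> {w \<in> verts G. (x, w) \<in> arcs_ends G}"
        using xy V u adj[OF V(1) \<open>x \<noteq> u\<close>] arcs_ends_symmetric[OF sym_arcs] by auto
      then have "card {u, y} \<le> out_degree G x"
        unfolding out_degree_eq_card by (intro card_mono) auto
      then show False
        using deg[OF V(1) \<open>x \<noteq> u\<close>] \<open>y \<noteq> u\<close> by auto
    qed
    then show "(x, y) \<in> {u} \<times> (verts G - {u}) \<union> (verts G - {u}) \<times> {u}"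
      using V \<open>x \<noteq> y\<close> by auto
  qed
  moreover have "{u} \<times> (verts G - {u}) \<union> (verts G - {u}) \<times> {u} \<subseteq> arcs_ends G"
    using adj arcs_ends_symmetric[OF sym_arcs] by auto
  ultimately have arcs: "arcs_ends G = {u} \<times> (verts G - {u}) \<union> (verts G - {u}) \<times> {u}"
    by blast
  show ?thesis
    unfolding is_star_def complete_bipartite_digraph_def
    by (rule conjI[OF graph_axioms], rule exI[of _ "{u}"], rule exI[of _ "verts G - {u}"])
      (use u n arcs in auto)
qed

lemma (in graph) is_starE:
  assumes "is_star n G"
  obtains c where "c \<in> verts G" "arcs_ends G = {c} \<times> (verts G - {c}) \<union> (verts G - {c}) \<times> {c}"
proof -
  obtain U W where *: "verts G = U \<union> W" "U \<inter> W = {}" "card U = 1" "arcs_ends G = U \<times> W \<union> W \<times> U"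
    using assms unfolding is_star_def complete_bipartite_digraph_def by blast
  moreover obtain c where "U = {c}"
    using * by (auto simp: card_1_singleton_iff)
  ultimately have "W = verts G - {c}"
    by auto
  then show thesis
    using * \<open>U = {c}\<close> by (intro that[of c]) auto
qed

text \<open>The first test matrix leaves a slack with two nonnegative parts, from common neighbours
  of \<open>u\<close> and \<open>v\<close> and from edges between \<open>A\<close> and
  \<open>B\<close>. If the inequality is not strict both parts vanish, which determines the graph up
  to edges among the neighbours.\<close>

lemma (in graph) two_largest_ge_degrees:
  assumes conn: "Digraph_Component.connected G" and n: "card (verts G) = n" "3 \<le> n"
    and vs: "distinct vs" "set vs = verts G"
    and uv: "u \<in> verts G" "v \<in> verts G" "u \<noteq> v"
    and max: "out_degree G v \<le> out_degree G u"
      "\<And>w. w \<in> verts G \<Longrightarrow> w \<noteq> u \<Longrightarrow> out_degree G w \<le> out_degree G v"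
  defines "d \<equiv> real (out_degree G u) + real (out_degree G v) + 1"
    and "lam \<equiv> laplacian_eigenvalue G vs 1 + laplacian_eigenvalue G vs 2"
  shows "d \<le> lam" and "\<not> is_star n G \<Longrightarrow> d < lam"
proof -
  let ?E = "arcs_ends G"
  have len: "2 \<le> length vs"
    using vs n distinct_card[of vs] by simp
  have sym: "(y, x) \<in> ?E" if "(x, y) \<in> ?E" for x y
    using that arcs_ends_symmetric[OF sym_arcs] by blast
  have irrefl: "(x, x) \<notin> ?E" for x
    using adj_not_same by blast
  define A where "A = {w \<in> verts G - {u, v}. (u, w) \<in> ?E \<or> (v, w) \<in> ?E}"
  define B where "B = verts G - {u, v} - A"
  define Au where "Au = {w \<in> A. (u, w) \<in> ?E}"
  define Av where "Av = {w \<in> A. (v, w) \<in> ?E}"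
  have fin: "finite A" "finite B" "finite Au" "finite Av"
    by (simp_all add: A_def B_def Au_def Av_def)
  have blocks: "four_blocks (verts G) ?E u v A B"
    by unfold_locales (use uv sym in \<open>auto simp: A_def B_def\<close>)
  \<comment> \<open>Because of \<open>3 \<le> n\<close> there is a third vertex, so connectivity
    gives an edge leaving \<open>{u, v}\<close>.\<close>
  have "card {u, v} \<noteq> card (verts G)"
    using n uv(3) by simp
  then have "{u, v} \<noteq> verts G"
    by (rule contrapos_nn) (rule arg_cong)
  then obtain x y where "x \<in> {u, v}" "y \<in> verts G - {u, v}" "(x, y) \<in> ?E"
    using connected_cut[OF conn, of "{u, v}"] uv by auto
  then have "A \<noteq> {}"
    by (auto simp: A_def)
  define k where "k = real (card A)"
  define t where "t = edge_count ?E A B"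
  have k: "0 < k" and t: "0 \<le> t"
    using \<open>A \<noteq> {}\<close> fin by (simp_all add: k_def t_def card_gt_0_iff edge_count_nonneg)
  have uB: "edge_count ?E {u} B = 0" and vB: "edge_count ?E {v} B = 0"
    using fin unfolding edge_count_singleton[OF fin(2)] by (auto simp: B_def A_def)
  have uA: "edge_count ?E {u} A = card Au" and vA: "edge_count ?E {v} A = card Av"
    using fin by (simp_all only: edge_count_singleton Au_def Av_def)
  have "A = Au \<union> Av"
    by (auto simp: A_def Au_def Av_def)
  \<comment> \<open>Inclusion-exclusion: divided by \<open>k\<close>, the term \<open>k\<close>
    yields the summand 1 of the theorem.\<close>
  then have s: "real (card Au) + real (card Av) = k + real (card (Au \<inter> Av))"
    unfolding k_def using card_Un_Int[of Au Av] fin by simp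
  have bound: "d + real (card (Au \<inter> Av)) / k + (t / k - t / (k + 2)) \<le> lam"
    using two_largest_ge_neighbourhood[OF vs len blocks \<open>A \<noteq> {}\<close> uB vB] k
    unfolding uA vA s d_def lam_def by (simp add: add_divide_distrib flip: k_def t_def)
  have t': "0 \<le> t / k - t / (k + 2)"
    using k t by (simp add: frac_le)
  show "d \<le> lam"
    using bound t' k divide_nonneg_pos[of "real (card (Au \<inter> Av))" k] by linarith
  show "d < lam" if "\<not> is_star n G"
  proof (rule ccontr)
    assume "\<not> d < lam"
    then have "real (card (Au \<inter> Av)) / k \<le> 0" "t / k - t / (k + 2) \<le> 0"
      using bound t' k divide_nonneg_pos[of "real (card (Au \<inter> Av))" k] by linarith+
    then have "Au \<inter> Av = {}" and "t / k \<le> t / (k + 2)"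
      using k fin by (auto simp: divide_le_0_iff)
    then have "t = 0"
      using k t divide_strict_left_mono[of k "k + 2" t] by fastforce
    \<comment> \<open>Otherwise connectivity gives an edge into \<open>B\<close>. It can only start
      in \<open>A\<close>, contradicting \<open>t = 0\<close>.\<close>
    have "B = {}"
    proof (rule ccontr)
      assume "B \<noteq> {}"
      then have "{u, v} \<union> A \<noteq> verts G"
        by (auto simp: B_def)
      then obtain x y where xy: "x \<in> {u, v} \<union> A" "y \<in> verts G - ({u, v} \<union> A)" "(x, y) \<in> ?E"
        using connected_cut[OF conn, of "{u, v} \<union> A"] uv by (auto simp: A_def)
      then have "x \<in> A" "y \<in> B"
        by (auto simp: A_def B_def)
      then have "0 < t"
        unfolding t_def using xy fin by (intro edge_count_pos) auto
      with \<open>t = 0\<close> show False by simp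
    qed
    then have V: "verts G = {u} \<union> {v} \<union> Au \<union> Av"
      using uv \<open>A = Au \<union> Av\<close> by (auto simp: B_def Au_def Av_def A_def)
    have ne: "{u} \<noteq> verts G" "{v} \<noteq> verts G"
      using uv by (metis singletonD)+
    \<comment> \<open>A vertex of the pair without neighbours in \<open>A\<close> can be connected
      to the rest only through the other one.\<close>
    have nbr: "(u, v) \<in> ?E" if "Au = {} \<or> Av = {}"
    proof (cases "Au = {}")
      case True
      obtain x y where "x \<in> {u}" "y \<in> verts G - {u}" "(x, y) \<in> ?E"
        using connected_cut[OF conn, of "{u}"] uv ne by auto
      with True show ?thesis
        by (auto simp: Au_def A_def)
    next
      case False
      with that have "Av = {}" by simp
      obtain x y where "x \<in> {v}" "y \<in> verts G - {v}" "(x, y) \<in> ?E"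
        using connected_cut[OF conn, of "{v}"] uv ne by auto
      with \<open>Av = {}\<close> show ?thesis
        using sym by (auto simp: Av_def A_def)
    qed
    note deg = degree_blocks[OF blocks, unfolded uA vA uB vB edge_count_singletons]
    consider "Av = {}" | "Au = {}" "Av \<noteq> {}" | "Au \<noteq> {}" "Av \<noteq> {}"
      by blast
    then show False
    proof cases
      \<comment> \<open>Here \<open>v\<close> is a leaf, so by the choice of \<open>v\<close> all
        vertices except \<open>u\<close> have degree at most 1. All of them are adjacent to
        \<open>u\<close>.\<close>
      case 1
      then have "out_degree G v \<le> 1"
        using deg(2) nbr by simp
      moreover have "(u, w) \<in> ?E" if "w \<in> verts G" "w \<noteq> u" for w
        using that nbr 1 V by (auto simp: Au_def)
      ultimately have "is_star n G"
        using max(2) uv n by (intro is_starI[of u]) (auto intro: order_trans)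
      with that show False by simp
    next
      \<comment> \<open>Here \<open>u\<close> would be a leaf and \<open>v\<close> of degree at
        least 2, against the choice of \<open>u\<close>.\<close>
      case 2
      then have "out_degree G u \<le> 1" "out_degree G v = 1 + card Av"
        using deg nbr by simp_all
      moreover have "0 < card Av"
        using 2 fin by (simp add: card_gt_0_iff)
      ultimately show False
        using max(1) by simp
    next
      case 3
      have "u \<notin> Au" "u \<notin> Av" "v \<notin> Au" "v \<notin> Av"
        by (auto simp: A_def Au_def Av_def)
      then have blocks': "four_blocks (verts G) ?E u v Au Av"
        using uv(3) \<open>Au \<inter> Av = {}\<close> sym by (intro four_blocks.intro[OF finite_verts V])
      have "{w \<in> Au. (u, w) \<in> ?E} = Au" "{w \<in> Av. (v, w) \<in> ?E} = Av"
        "{w \<in> Av. (u, w) \<in> ?E} = {}" "{w \<in> Au. (v, w) \<in> ?E} = {}"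
        using \<open>Au \<inter> Av = {}\<close> by (auto simp: Au_def Av_def)
      then have "d < lam"
        unfolding d_def lam_def using fin
        by (intro two_largest_greater_double_star[OF vs len blocks' 3])
          (simp_all only: edge_count_singleton card.empty of_nat_0)
      with \<open>\<not> d < lam\<close> show False by simp
    qed
  qed
qed

section \<open>Equality for the star\<close>

text \<open>With \<open>s\<close> the sum of the entries of \<open>x\<close>, the form is the
  squared norm of \<open>x\<close> plus \<open>n * (x c)\<^sup>2 - 2 * x c * s\<close>. Completing
  the square turns this addition into \<open>n\<close> times the square of
  \<open>x c - s / n\<close>, the product of \<open>x\<close> with \<open>h\<close>, minus
  \<open>s\<^sup>2 / n\<close>.\<close>

lemma (in graph) dirichlet_star:
  assumes c: "c \<in> verts G" and E: "arcs_ends G = {c} \<times> (verts G - {c}) \<union> (verts G - {c}) \<times> {c}"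
  defines "n \<equiv> real (card (verts G))"
  defines "h \<equiv> \<lambda>v. (if v = c then 1 else 0) - 1 / n"
  shows "dirichlet (verts G) (arcs_ends G) x \<le> ip (verts G) x x + n * (ip (verts G) x h)\<^sup>2"
    and "ip (verts G) h h = 1 - 1 / n"
proof -
  let ?V = "verts G" and ?L = "verts G - {c}"
  have V: "(\<Sum>v\<in>?V. f v) = f c + (\<Sum>v\<in>?L. f v)" for f :: "'a \<Rightarrow> real"
    using c by (simp add: sum.remove)
  have n: "0 < n" and card_L: "real (card ?L) = n - 1"
    unfolding n_def card_Suc_Diff1[OF finite_verts c, symmetric] by simp_all
  have xh: "ip ?V x h = x c - (\<Sum>v\<in>?V. x v) / n" for x
  proof -
    have "ip ?V x h = (\<Sum>v\<in>?V. (if v = c then x v else 0) - x v / n)"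
      unfolding ip_def h_def by (intro sum.cong) (auto simp: algebra_simps)
    then show ?thesis
      using c by (simp add: sum_subtractf sum_divide_distrib)
  qed
  \<comment> \<open>Since \<open>h\<close> has mean 0, \<open>xh\<close> applied to \<open>h\<close>
    itself gives \<open>h c\<close>.\<close>
  have "(\<Sum>v\<in>?V. h v) = 0"
    using c n by (simp add: h_def sum_subtractf flip: n_def)
  then show "ip ?V h h = 1 - 1 / n"
    unfolding xh by (simp add: h_def)
  define s where "s = (\<Sum>v\<in>?V. x v)"
  have 1: "(\<Sum>w\<in>?V. of_bool ((v, w) \<in> arcs_ends G) * (x v - x w)\<^sup>2) = (x v - x c)\<^sup>2" if "v \<in> ?L" for v
    unfolding V using that by (subst sum.neutral) (auto simp: E)
  have 2: "(\<Sum>w\<in>?V. of_bool ((c, w) \<in> arcs_ends G) * (x c - x w)\<^sup>2) = (\<Sum>w\<in>?L. (x w - x c)\<^sup>2)"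
    unfolding V by (auto simp: E power2_commute intro!: sum.cong)
  have "2 * dirichlet ?V (arcs_ends G) x = (\<Sum>w\<in>?L. (x w - x c)\<^sup>2) + (\<Sum>v\<in>?L. (x v - x c)\<^sup>2)"
    unfolding dirichlet_def by (subst V) (simp only: 1 2 sum.cong[OF refl 1], simp)
  then have "dirichlet ?V (arcs_ends G) x = (\<Sum>w\<in>?L. (x w)\<^sup>2 - 2 * x c * x w + (x c)\<^sup>2)"
    by (simp add: power2_eq_square algebra_simps)
  also have "\<dots> = (\<Sum>w\<in>?L. (x w)\<^sup>2) - 2 * x c * (\<Sum>w\<in>?L. x w) + (n - 1) * (x c)\<^sup>2"
    by (simp add: sum.distrib sum_subtractf sum_distrib_left card_L del: card_Diff_insert)
  also have "\<dots> = ip ?V x x - 2 * x c * s + n * (x c)\<^sup>2"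
    unfolding s_def ip_def V by (simp add: power2_eq_square algebra_simps)
  also have "\<dots> \<le> ip ?V x x - 2 * x c * s + n * (x c)\<^sup>2 + s\<^sup>2 / n"
    using n by simp
  also have "\<dots> = ip ?V x x + n * (ip ?V x h)\<^sup>2"
    unfolding xh s_def[symmetric] using n by (simp add: power2_eq_square field_simps)
  finally show "dirichlet ?V (arcs_ends G) x \<le> ip ?V x x + n * (ip ?V x h)\<^sup>2" .
qed

lemma (in graph) star_two_largest_le:
  assumes "is_star n G" and n: "card (verts G) = n" "3 \<le> n"
    and vs: "distinct vs" "set vs = verts G"
  shows "laplacian_eigenvalue G vs 1 + laplacian_eigenvalue G vs 2 \<le> real n + 1"
proof -
  let ?V = "verts G"
  obtain c where c: "c \<in> ?V" and E: "arcs_ends G = {c} \<times> (?V - {c}) \<union> (?V - {c}) \<times> {c}"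
    using is_starE[OF assms(1)] .
  define h where "h v = (if v = c then 1 else 0) - 1 / real n" for v
  have len: "2 \<le> length vs"
    using vs n distinct_card[of vs] by simp
  obtain x y where xy: "ip ?V x x = 1" "ip ?V y y = 1"
    "laplacian_eigenvalue G vs 1 = dirichlet ?V (arcs_ends G) x"
    "laplacian_eigenvalue G vs 2 = dirichlet ?V (arcs_ends G) y"
    "(ip ?V x h)\<^sup>2 + (ip ?V y h)\<^sup>2 \<le> ip ?V h h"
    by (rule two_largest_attained[OF vs len]) (rule that; assumption | blast)
  note star = dirichlet_star[OF c E, unfolded n(1), folded h_def]
  have "laplacian_eigenvalue G vs 1 + laplacian_eigenvalue G vs 2
      \<le> 2 + real n * ((ip ?V x h)\<^sup>2 + (ip ?V y h)\<^sup>2)"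
    using star(1)[of x] star(1)[of y] xy(1,2)
    unfolding xy(3,4) distrib_left by linarith
  also have "\<dots> \<le> 2 + real n * (1 - 1 / real n)"
    using xy(5) star(2) by (intro add_left_mono mult_left_mono) auto
  also have "\<dots> = real n + 1"
    using n by (simp add: right_diff_distrib)
  finally show ?thesis .
qed

text \<open>For \<open>3 \<le> n\<close> the centre has degree \<open>n - 1\<close>, at least 2,
  while leaves have degree 1. Hence \<open>u\<close> is the centre and \<open>v\<close> a
  leaf.\<close>

lemma (in graph) star_two_largest_degrees:
  assumes "is_star n G" and n: "card (verts G) = n" "3 \<le> n"
    and uv: "u \<in> verts G" "v \<in> verts G" "u \<noteq> v"
    and max: "out_degree G v \<le> out_degree G u"
      "\<And>w. w \<in> verts G \<Longrightarrow> w \<noteq> u \<Longrightarrow> out_degree G w \<le> out_degree G v"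
  shows "out_degree G u + out_degree G v = n"
proof -
  obtain c where c: "c \<in> verts G"
    and E: "arcs_ends G = {c} \<times> (verts G - {c}) \<union> (verts G - {c}) \<times> {c}"
    using is_starE[OF assms(1)] .
  have leaf: "out_degree G w = 1" if "w \<in> verts G" "w \<noteq> c" for w
  proof -
    have "{y \<in> verts G. (w, y) \<in> arcs_ends G} = {c}"
      using that c by (auto simp: E)
    then show ?thesis
      unfolding out_degree_eq_card by simp
  qed
  have "{y \<in> verts G. (c, y) \<in> arcs_ends G} = verts G - {c}"
    using c by (auto simp: E)
  then have centre: "out_degree G c = n - 1"
    unfolding out_degree_eq_card using c n by simp
  have "u = c"
    using leaf[OF uv(1)] max(1) max(2)[OF c] centre n by fastforce
  then show ?thesis
    using centre leaf[OF uv(2)] uv n by simp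
qed

text \<open>Sorting the vertices by degree, instead of the degrees alone, yields two distinct
  vertices even when the two largest degrees coincide.\<close>

lemma ordered_degree_attained:
  assumes vs: "distinct vs" "set vs = verts G" "2 \<le> length vs"
  obtains u v where "u \<in> verts G" "v \<in> verts G" "u \<noteq> v"
    "ordered_degree G 1 = out_degree G u" "ordered_degree G 2 = out_degree G v"
    "out_degree G v \<le> out_degree G u"
    "\<And>w. w \<in> verts G \<Longrightarrow> w \<noteq> u \<Longrightarrow> out_degree G w \<le> out_degree G v"
proof -
  let ?d = "out_degree G"
  define xs where "xs = rev (sort_key ?d vs)"
  have xs: "distinct xs" "set xs = verts G" "2 \<le> length xs"
    using vs by (simp_all add: xs_def)
  have "image_mset ?d (mset_set (verts G)) = mset (map ?d (sort_key ?d vs))"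
    using mset_set_set[OF vs(1)] vs(2) by simp
  then have "sorted_list_of_multiset (image_mset ?d (mset_set (verts G))) = map ?d (sort_key ?d vs)"
    by (simp only: sorted_list_of_multiset_mset) (simp add: sorted_sort_id)
  then have ord_nth: "ordered_degree G (Suc k) = map ?d xs ! k" for k
    unfolding ordered_degree_def xs_def by (simp add: rev_map)
  have len: "0 < length xs" "1 < length xs"
    using xs(3) by auto
  then have ord: "ordered_degree G 1 = ?d (xs ! 0)" "ordered_degree G 2 = ?d (xs ! 1)"
    using ord_nth[of 0] ord_nth[of 1] by (simp_all add: numeral_2_eq_2)
  have desc: "?d (xs ! j) \<le> ?d (xs ! i)" if "i \<le> j" "j < length xs" for i j
  proof -
    have "sorted (rev (map ?d xs))"
      by (simp add: xs_def rev_map)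
    then show ?thesis
      using sorted_rev_nth_mono[of "map ?d xs" i j] that by simp
  qed
  show thesis
  proof (rule that[of "xs ! 0" "xs ! 1"])
    show "xs ! 0 \<in> verts G" "xs ! 1 \<in> verts G"
      using len nth_mem unfolding xs(2)[symmetric] by blast+
    show "xs ! 0 \<noteq> xs ! 1"
      using xs by (subst nth_eq_iff_index_eq) auto
    show "?d (xs ! 1) \<le> ?d (xs ! 0)"
      using xs by (intro desc) auto
    fix w assume "w \<in> verts G" "w \<noteq> xs ! 0"
    then obtain j where "j < length xs" "w = xs ! j" "j \<noteq> 0"
      using xs by (metis in_set_conv_nth)
    then show "?d w \<le> ?d (xs ! 1)"
      using desc[of 1 j] by simp
  qed (rule ord)+
qed

theorem theorem3p9:
  fixes G :: "('a, 'b) pre_digraph" and vs :: "'a list" and n :: nat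
  assumes "graph G"
    and "Digraph_Component.connected G"
    and "card (verts G) = n" and "n \<ge> 3"
    and "distinct vs" and "set vs = verts G"
  shows "laplacian_eigenvalue G vs 1 + laplacian_eigenvalue G vs 2
           \<ge> real (ordered_degree G 1) + real (ordered_degree G 2) + 1
       \<and> (laplacian_eigenvalue G vs 1 + laplacian_eigenvalue G vs 2
            = real (ordered_degree G 1) + real (ordered_degree G 2) + 1
          \<longleftrightarrow> is_star n G)"
proof -
  interpret graph G by fact
  have "2 \<le> length vs"
    using assms(3-6) distinct_card[of vs] by simp
  obtain u v where
    uv: "u \<in> verts G" "v \<in> verts G" "u \<noteq> v"
    and ord: "ordered_degree G 1 = out_degree G u" "ordered_degree G 2 = out_degree G v"
    and max: "out_degree G v \<le> out_degree G u"
      "\<And>w. w \<in> verts G \<Longrightarrow> w \<noteq> u \<Longrightarrow> out_degree G w \<le> out_degree G v"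
    by (rule ordered_degree_attained[OF assms(5,6) \<open>2 \<le> length vs\<close>]) (rule that; assumption)
  note bound = two_largest_ge_degrees[OF assms(2-6) uv max]
  \<comment> \<open>With the general lower bound this gives equality for the star; the strict bound
    for all other graphs gives the converse.\<close>
  have "laplacian_eigenvalue G vs 1 + laplacian_eigenvalue G vs 2
      \<le> real (out_degree G u) + real (out_degree G v) + 1" if "is_star n G"
    using star_two_largest_le[OF that assms(3-6)]
      star_two_largest_degrees[OF that assms(3,4) uv max] by linarith
  then show ?thesis
    unfolding ord using bound by force
qed

end
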